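(* Let $q\in(0,1)$, let $k$ be an integer and let $l$ be a positive integer coprime with $k$. Let $\mathcal{O}(\Sigma^3_q)$ be the coordinate $*$-algebra of the quantum Seifert manifold with generators $\zeta_0,\zeta_1,\xi$, and let $\varrho_{k,l}$ be the coaction of $\mathcal{O}(U(1))$ on it (both defined in the context). (1) If $k=2s$ is even, then the $*$-subalgebra of $\varrho_{k,l}$-coinvariant elements of $\mathcal{O}(\Sigma^3_q)$ is generated, as a $*$-algebra, by $a=\zeta_1^2\xi$ and $c_+=\zeta_0^l\xi^s$, which satisfy the relations $$a^*=a,\qquad ac_+=q^{-2l}c_+a,\qquad c_+c_+^*=\prod_{m=0}^{l-1}(1-q^{2m}a),\qquad c_+^*c_+=\prod_{m=1}^{l}(1-q^{-2m}a).$$ (2) If $k=2s-1$ is odd, then the $*$-subalgebra of $\varrho_{k,l}$-coinvariant elements of $\mathcal{O}(\Sigma^3_q)$ is generated, as a $*$-algebra, by $a=\zeta_1^2\xi$, $b=\zeta_0^l\zeta_1\xi^s$ and $c_-=\zeta_0^{2l}\xi^k$, which satisfy the relations $$a^*=a,\qquad ab=q^{-2l}ba,\qquad ac_-=q^{-4l}c_-a,\qquad b^2=q^{3l}ac_-,\qquad bc_-=q^{-2l}c_-b,$$ $$bb^*=q^{2l}a\prod_{m=0}^{l-1}(1-q^{2m}a),\qquad b^*b=a\prod_{m=1}^{l}(1-q^{-2m}a),\qquad b^*c_-=q^{-l}\prod_{m=1}^{l}(1-q^{-2m}a)\,b,$$ $$c_-b^*=q^{l}b\prod_{m=0}^{l-1}(1-q^{2m}a),\qquad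 c_-c_-^*=\prod_{m=0}^{2l-1}(1-q^{2m}a),\qquad c_-^*c_-=\prod_{m=1}^{2l}(1-q^{-2m}a).$$
   Context: All algebras are unital associative $*$-algebras over $\mathbb{C}$. $\mathcal{O}(\Sigma^3_q)$ is the $*$-algebra generated by $\zeta_0,\zeta_1$ and a central unitary $\xi$ subject to the relations $$\zeta_0\zeta_1=q\zeta_1\zeta_0,\qquad \zeta_0\zeta_0^*=\zeta_0^*\zeta_0+(q^{-2}-1)\zeta_1^2\xi,\qquad \zeta_0\zeta_0^*+\zeta_1^2\xi=1,\qquad \zeta_1^*=\zeta_1\xi.$$ Negative powers of $\xi$ are understood via $\xi^{-1}=\xi^*$. A linear basis of $\mathcal{O}(\Sigma^3_q)$ is given by the elements $\zeta_0^m\zeta_1^p\xi^r$ and $(\zeta_0^* )^m\zeta_1^p\xi^r$ with $m,p\in\mathbb{N}=\{0,1,2,\dots\}$, $r\in\mathbb{Z}$ (the elements with $m=0$ being counted once). $\mathcal{O}(U(1))=\mathbb{C}[u,u^*]$ is the Hopf $*$-algebra of Laurent polynomials in a unitary grouplike element $u$. The coaction $\varrho_{k,l}:\mathcal{O}(\Sigma^3_q)\to\mathcal{O}(\Sigma^3_q)\otimes\mathbb{C}[u,u^*]$ is the unital $*$-algebra homomorphism with $$\varrho_{k,l}(\zeta_0)=\zeta_0\otimes u^k,\qquad \varrho_{k,l}(\zeta_1)=\zeta_1\otimes u^l,\qquad \varrho_{k,l}(\xi)=\xi\otimes u^{-2l}.$$ An element $x$ is $\varrho_{k,l}$-coinvariant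 if $\varrho_{k,l}(x)=x\otimes 1$. *)

theory Defs
  imports Complex_Main "HOL-Library.Poly_Mapping" "HOL-Algebra.Module" "HOL-Algebra.QuotRing"
    "HOL-Algebra.Elementary_Groups"
begin

section \<open>Unital associative complex \<open>*\<close>-algebras\<close>

definition complex_ring :: "complex ring" (\<open>\<complex>\<close>)
  where "\<complex> = \<lparr>carrier = UNIV, mult = (*), one = 1, zero = 0, add = (+)\<rparr>"

record 'a star_algebra = "(complex, 'a) module" +
  star :: "'a \<Rightarrow> 'a"

locale star_algebra = module \<complex> A + ring A for A (structure) +
  assumes smult_mult_left:
      "x \<in> carrier A \<Longrightarrow> y \<in> carrier A \<Longrightarrow> (c \<odot> x) \<otimes> y = c \<odot> (x \<otimes> y)"
    and smult_mult_right:
      "x \<in> carrier A \<Longrightarrow> y \<in> carrier A \<Longrightarrow> x \<otimes> (c \<odot> y) = c \<odot> (x \<otimes> y)"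
    and star_closed: "x \<in> carrier A \<Longrightarrow> star A x \<in> carrier A"
    and star_star: "x \<in> carrier A \<Longrightarrow> star A (star A x) = x"
    and star_add:
      "x \<in> carrier A \<Longrightarrow> y \<in> carrier A \<Longrightarrow> star A (x \<oplus> y) = star A x \<oplus> star A y"
    and star_smult: "x \<in> carrier A \<Longrightarrow> star A (c \<odot> x) = cnj c \<odot> star A x"
    and star_mult:
      "x \<in> carrier A \<Longrightarrow> y \<in> carrier A \<Longrightarrow> star A (x \<otimes> y) = star A y \<otimes> star A x"

definition star_hom ::
    "('a, 'm) star_algebra_scheme \<Rightarrow> ('b, 'n) star_algebra_scheme \<Rightarrow> ('a \<Rightarrow> 'b) set"
  where "star_hom A B =
    {h \<in> ring_hom A B.
      (\<forall>c. \<forall>x\<in>carrier A. h (c \<odot>\<^bsub>A\<^esub> x) = c \<odot>\<^bsub>B\<^esub> h x) \<and>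
      (\<forall>x\<in>carrier A. h (star A x) = star B (h x))}"

definition star_subalgebra :: "'a set \<Rightarrow> ('a, 'm) star_algebra_scheme \<Rightarrow> bool"
  where "star_subalgebra B A \<longleftrightarrow>
    submodule B \<complex> A \<and> \<one>\<^bsub>A\<^esub> \<in> B \<and>
    (\<forall>x\<in>B. \<forall>y\<in>B. x \<otimes>\<^bsub>A\<^esub> y \<in> B) \<and> (\<forall>x\<in>B. star A x \<in> B)"

definition star_generate :: "('a, 'm) star_algebra_scheme \<Rightarrow> 'a set \<Rightarrow> 'a set"
  where "star_generate A S = \<Inter>{B. star_subalgebra B A \<and> S \<subseteq> B}"

definition star_ideal :: "'a set \<Rightarrow> ('a, 'm) star_algebra_scheme \<Rightarrow> bool"
  where "star_ideal J A \<longleftrightarrow> ideal J A \<and> (\<forall>x\<in>J. star A x \<in> J)"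

definition genstarideal :: "('a, 'm) star_algebra_scheme \<Rightarrow> 'a set \<Rightarrow> 'a set"
  where "genstarideal A S = \<Inter>{J. star_ideal J A \<and> S \<subseteq> J}"

definition star_quotient ::
    "('a, 'm) star_algebra_scheme \<Rightarrow> 'a set \<Rightarrow> 'a set star_algebra"
  where "star_quotient A J =
    \<lparr>carrier = carrier (A Quot J), mult = mult (A Quot J), one = one (A Quot J),
     zero = zero (A Quot J), add = add (A Quot J),
     smult = (\<lambda>c X. \<Union>x\<in>X. J +>\<^bsub>A\<^esub> (c \<odot>\<^bsub>A\<^esub> x)),
     star = (\<lambda>X. \<Union>x\<in>X. J +>\<^bsub>A\<^esub> star A x)\<rparr>"

text \<open>Integer powers of a unitary, with \<open>x\<^sup>-\<^sup>1 = x\<^sup>*\<close>.\<close>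

definition unitary_pow :: "('a, 'm) star_algebra_scheme \<Rightarrow> 'a \<Rightarrow> int \<Rightarrow> 'a"
  where "unitary_pow A x n =
    (if n \<ge> 0 then x [^]\<^bsub>A\<^esub> nat n else star A x [^]\<^bsub>A\<^esub> nat (- n))"

text \<open>
  Ordered product of the values of \<open>f\<close> at \<open>i, i + 1, \<dots>, j - 1\<close>. The library's \<^const>\<open>finprod\<close>
  is reserved for commutative monoids.
\<close>

definition ordered_prod :: "('a, 'm) monoid_scheme \<Rightarrow> (nat \<Rightarrow> 'a) \<Rightarrow> nat \<Rightarrow> nat \<Rightarrow> 'a"
  where "ordered_prod A f i j = foldr (\<otimes>\<^bsub>A\<^esub>) (map f [i..<j]) \<one>\<^bsub>A\<^esub>"


section \<open>Constructions of \<open>*\<close>-algebras\<close>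

text \<open>
  The complex monoid algebra of \<open>M\<close>, where \<open>\<sigma>\<close> is an involutive anti-automorphism of \<open>M\<close>,
  extended antilinearly. The basis element of \<open>x\<close> is \<^term>\<open>Poly_Mapping.single x (1::complex)\<close>.
\<close>

definition monoid_star_algebra ::
    "('m, 'r) monoid_scheme \<Rightarrow> ('m \<Rightarrow> 'm) \<Rightarrow> ('m \<Rightarrow>\<^sub>0 complex) star_algebra"
  where "monoid_star_algebra M \<sigma> =
    \<lparr>carrier = {f. Poly_Mapping.keys f \<subseteq> carrier M},
     mult = (\<lambda>f g. \<Sum>x\<in>Poly_Mapping.keys f. \<Sum>y\<in>Poly_Mapping.keys g.
       Poly_Mapping.single (x \<otimes>\<^bsub>M\<^esub> y) (Poly_Mapping.lookup f x * Poly_Mapping.lookup g y)),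
     one = Poly_Mapping.single \<one>\<^bsub>M\<^esub> 1, zero = 0, add = (+),
     smult = (\<lambda>c. Poly_Mapping.map ((*) c)),
     star = (\<lambda>f. \<Sum>x\<in>Poly_Mapping.keys f. Poly_Mapping.single (\<sigma> x) (cnj (Poly_Mapping.lookup f x)))\<rparr>"

text \<open>
  The free \<open>*\<close>-algebra on a type of generators: the letters are \<open>(g, False)\<close> for a generator
  \<open>g\<close> and \<open>(g, True)\<close> for its adjoint.
\<close>

definition free_star_algebra :: "(('g \<times> bool) list \<Rightarrow>\<^sub>0 complex) star_algebra"
  where "free_star_algebra =
    monoid_star_algebra \<lparr>carrier = UNIV, mult = (@), one = []\<rparr> (\<lambda>w. rev (map (apsnd Not) w))"

definition free_gen :: "'g \<Rightarrow> (('g \<times> bool) list \<Rightarrow>\<^sub>0 complex)"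
  where "free_gen g = Poly_Mapping.single [(g, False)] 1"

text \<open>
  The \<open>*\<close>-algebra on a type of generators subject to the relations \<open>x = y\<close> for \<open>(x, y) \<in> R\<close>.
\<close>

definition relation_ideal ::
    "((('g \<times> bool) list \<Rightarrow>\<^sub>0 complex) \<times> (('g \<times> bool) list \<Rightarrow>\<^sub>0 complex)) set
      \<Rightarrow> (('g \<times> bool) list \<Rightarrow>\<^sub>0 complex) set"
  where "relation_ideal R =
    genstarideal free_star_algebra {x \<ominus>\<^bsub>free_star_algebra\<^esub> y | x y. (x, y) \<in> R}"

definition presented_star_algebra ::
    "((('g \<times> bool) list \<Rightarrow>\<^sub>0 complex) \<times> (('g \<times> bool) list \<Rightarrow>\<^sub>0 complex)) set
      \<Rightarrow> (('g \<times> bool) list \<Rightarrow>\<^sub>0 complex) set star_algebra"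
  where "presented_star_algebra R = star_quotient free_star_algebra (relation_ideal R)"

definition presented_gen ::
    "((('g \<times> bool) list \<Rightarrow>\<^sub>0 complex) \<times> (('g \<times> bool) list \<Rightarrow>\<^sub>0 complex)) set
      \<Rightarrow> 'g \<Rightarrow> (('g \<times> bool) list \<Rightarrow>\<^sub>0 complex) set"
  where "presented_gen R g = relation_ideal R +>\<^bsub>free_star_algebra\<^esub> free_gen g"

text \<open>
  The algebraic tensor product over \<open>\<complex>\<close>: the free vector space on \<open>A \<times> B\<close> modulo the subspace
  spanned by the bilinearity relators. The free vector space carries the multiplication
  \<open>(a, b)(a', b') = (aa', bb')\<close> and the involution \<open>(a, b)\<^sup>* = (a\<^sup>*, b\<^sup>*)\<close>, for which that
  subspace is a \<open>*\<close>-ideal.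
\<close>

definition pair_algebra ::
    "('a, 'm) star_algebra_scheme \<Rightarrow> ('b, 'n) star_algebra_scheme
      \<Rightarrow> ('a \<times> 'b \<Rightarrow>\<^sub>0 complex) star_algebra"
  where "pair_algebra A B = monoid_star_algebra (A \<times>\<times> B) (map_prod (star A) (star B))"

definition bilinear_relators ::
    "('a, 'm) star_algebra_scheme \<Rightarrow> ('b, 'n) star_algebra_scheme
      \<Rightarrow> ('a \<times> 'b \<Rightarrow>\<^sub>0 complex) set"
  where "bilinear_relators A B =
    (let e = (\<lambda>a b. Poly_Mapping.single (a, b) (1::complex)) in
      {e (a \<oplus>\<^bsub>A\<^esub> a') b - e a b - e a' b | a a' b.
         a \<in> carrier A \<and> a' \<in> carrier A \<and> b \<in> carrier B} \<union>
      {e a (b \<oplus>\<^bsub>B\<^esub> b') - e a b - e a b' | a b b'.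
         a \<in> carrier A \<and> b \<in> carrier B \<and> b' \<in> carrier B} \<union>
      {e (c \<odot>\<^bsub>A\<^esub> a) b - Poly_Mapping.single (a, b) c | c a b.
         a \<in> carrier A \<and> b \<in> carrier B} \<union>
      {e a (c \<odot>\<^bsub>B\<^esub> b) - Poly_Mapping.single (a, b) c | c a b.
         a \<in> carrier A \<and> b \<in> carrier B})"

definition tensor_kernel ::
    "('a, 'm) star_algebra_scheme \<Rightarrow> ('b, 'n) star_algebra_scheme
      \<Rightarrow> ('a \<times> 'b \<Rightarrow>\<^sub>0 complex) set"
  where "tensor_kernel A B =
    \<Inter>{V. submodule V \<complex> (pair_algebra A B) \<and> bilinear_relators A B \<subseteq> V}"

definition tensor_algebra ::
    "('a, 'm) star_algebra_scheme \<Rightarrow> ('b, 'n) star_algebra_scheme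
      \<Rightarrow> ('a \<times> 'b \<Rightarrow>\<^sub>0 complex) set star_algebra"
  where "tensor_algebra A B = star_quotient (pair_algebra A B) (tensor_kernel A B)"

definition pure_tensor ::
    "('a, 'm) star_algebra_scheme \<Rightarrow> ('b, 'n) star_algebra_scheme
      \<Rightarrow> 'a \<Rightarrow> 'b \<Rightarrow> ('a \<times> 'b \<Rightarrow>\<^sub>0 complex) set"
  where "pure_tensor A B a b =
    tensor_kernel A B +>\<^bsub>pair_algebra A B\<^esub> Poly_Mapping.single (a, b) 1"


section \<open>The quantum Seifert manifold and its circle coactions\<close>

text \<open>
  Laurent polynomials: the group algebra of the integers with \<open>(u\<^sup>n)\<^sup>* = u\<^sup>-\<^sup>n\<close>.
\<close>

definition O_U1 :: "(int \<Rightarrow>\<^sub>0 complex) star_algebra"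
  where "O_U1 = monoid_star_algebra integer_group uminus"

definition u_pow :: "int \<Rightarrow> (int \<Rightarrow>\<^sub>0 complex)"
  where "u_pow n = Poly_Mapping.single n 1"

datatype seifert_gen = Zeta0 | Zeta1 | Xi

type_synonym seifert_free = "(seifert_gen \<times> bool) list \<Rightarrow>\<^sub>0 complex"

text \<open>
  The centrality of \<open>\<xi>\<close> is imposed on the generators; the commutation of \<open>\<xi>\<close> with their
  adjoints follows because the ideal of relations is closed under the involution and
  \<open>\<xi>\<close> is unitary.
\<close>

definition seifert_relations :: "real \<Rightarrow> (seifert_free \<times> seifert_free) set"
  where "seifert_relations q =
    (let F = free_star_algebra;
         z0 = free_gen Zeta0; z1 = free_gen Zeta1; \<xi> = free_gen Xi
     in {(\<xi> \<otimes>\<^bsub>F\<^esub> star F \<xi>, \<one>\<^bsub>F\<^esub>),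
         (star F \<xi> \<otimes>\<^bsub>F\<^esub> \<xi>, \<one>\<^bsub>F\<^esub>),
         (\<xi> \<otimes>\<^bsub>F\<^esub> z0, z0 \<otimes>\<^bsub>F\<^esub> \<xi>),
         (\<xi> \<otimes>\<^bsub>F\<^esub> z1, z1 \<otimes>\<^bsub>F\<^esub> \<xi>),
         (z0 \<otimes>\<^bsub>F\<^esub> z1, complex_of_real q \<odot>\<^bsub>F\<^esub> (z1 \<otimes>\<^bsub>F\<^esub> z0)),
         (z0 \<otimes>\<^bsub>F\<^esub> star F z0,
          star F z0 \<otimes>\<^bsub>F\<^esub> z0 \<oplus>\<^bsub>F\<^esub>
            complex_of_real (q powi (-2) - 1) \<odot>\<^bsub>F\<^esub> (z1 [^]\<^bsub>F\<^esub> (2::nat) \<otimes>\<^bsub>F\<^esub> \<xi>)),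
         (z0 \<otimes>\<^bsub>F\<^esub> star F z0 \<oplus>\<^bsub>F\<^esub> z1 [^]\<^bsub>F\<^esub> (2::nat) \<otimes>\<^bsub>F\<^esub> \<xi>, \<one>\<^bsub>F\<^esub>),
         (star F z1, z1 \<otimes>\<^bsub>F\<^esub> \<xi>)})"

definition O_Sigma :: "real \<Rightarrow> seifert_free set star_algebra"
  where "O_Sigma q = presented_star_algebra (seifert_relations q)"

definition zeta0 :: "real \<Rightarrow> seifert_free set"
  where "zeta0 q = presented_gen (seifert_relations q) Zeta0"

definition zeta1 :: "real \<Rightarrow> seifert_free set"
  where "zeta1 q = presented_gen (seifert_relations q) Zeta1"

definition xi :: "real \<Rightarrow> seifert_free set"
  where "xi q = presented_gen (seifert_relations q) Xi"

definition xi_pow :: "real \<Rightarrow> int \<Rightarrow> seifert_free set"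
  where "xi_pow q n = unitary_pow (O_Sigma q) (xi q) n"

text \<open>
  The coaction takes values in the tensor product with \<^const>\<open>O_U1\<close>. It is determined on the
  carrier by its values on the generators; extensionality fixes it elsewhere.
\<close>

definition coaction ::
    "real \<Rightarrow> int \<Rightarrow> int \<Rightarrow> seifert_free set
      \<Rightarrow> (seifert_free set \<times> (int \<Rightarrow>\<^sub>0 complex) \<Rightarrow>\<^sub>0 complex) set"
  where "coaction q k l =
    (THE \<rho>. \<rho> \<in> star_hom (O_Sigma q) (tensor_algebra (O_Sigma q) O_U1) \<and>
       \<rho> \<in> extensional (carrier (O_Sigma q)) \<and>
       \<rho> (zeta0 q) = pure_tensor (O_Sigma q) O_U1 (zeta0 q) (u_pow k) \<and>
       \<rho> (zeta1 q) = pure_tensor (O_Sigma q) O_U1 (zeta1 q) (u_pow l) \<and>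
       \<rho> (xi q) = pure_tensor (O_Sigma q) O_U1 (xi q) (u_pow (- 2 * l)))"

definition coinvariants :: "real \<Rightarrow> int \<Rightarrow> int \<Rightarrow> seifert_free set set"
  where "coinvariants q k l =
    {x \<in> carrier (O_Sigma q).
       coaction q k l x = pure_tensor (O_Sigma q) O_U1 x \<one>\<^bsub>O_U1\<^esub>}"

text \<open>The product of the factors \<open>1 - q\<^sup>2\<^sup>m a\<close>, respectively \<open>1 - q\<^sup>-\<^sup>2\<^sup>m a\<close>, for \<open>i \<le> m < j\<close>.\<close>

definition prod_pos :: "real \<Rightarrow> seifert_free set \<Rightarrow> nat \<Rightarrow> nat \<Rightarrow> seifert_free set"
  where "prod_pos q a i j = ordered_prod (O_Sigma q)
    (\<lambda>m. \<one>\<^bsub>O_Sigma q\<^esub> \<ominus>\<^bsub>O_Sigma q\<^esub>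
      complex_of_real (q powi (2 * int m)) \<odot>\<^bsub>O_Sigma q\<^esub> a) i j"

definition prod_neg :: "real \<Rightarrow> seifert_free set \<Rightarrow> nat \<Rightarrow> nat \<Rightarrow> seifert_free set"
  where "prod_neg q a i j = ordered_prod (O_Sigma q)
    (\<lambda>m. \<one>\<^bsub>O_Sigma q\<^esub> \<ominus>\<^bsub>O_Sigma q\<^esub>
      complex_of_real (q powi (- 2 * int m)) \<odot>\<^bsub>O_Sigma q\<^esub> a) i j"

section \<open>The coaction is well defined\<close>

text \<open>
  All structures above satisfy the \<^locale>\<open>star_algebra\<close> axioms, and exactly one map meets the
  description used in the definition of \<^const>\<open>coaction\<close>: this is \<open>coaction_ex1\<close> below.
\<close>

lemma complex_ring_simps [simp]: "carrier \<complex> = UNIV" "x \<otimes>\<^bsub>\<complex>\<^esub> y = x * y" "x \<oplus>\<^bsub>\<complex>\<^esub> y = x + y" "\<one>\<^bsub>\<complex>\<^esub> = 1" "\<zero>\<^bsub>\<complex>\<^esub> = 0"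
  by (simp_all add: complex_ring_def)

lemma cring_complex_ring: "cring \<complex>"
proof (rule cringI)
  show "abelian_group \<complex>"
  proof (rule abelian_groupI)
    fix x :: complex show "\<exists>y\<in>carrier \<complex>. y \<oplus>\<^bsub>\<complex>\<^esub> x = \<zero>\<^bsub>\<complex>\<^esub>"
      by (auto intro: exI[of _ "-x"])
  qed (auto simp: algebra_simps)
  show "comm_monoid \<complex>" by (rule comm_monoidI) (auto simp: algebra_simps)
qed (auto simp: algebra_simps)

lemma poly_mapping_induct_on [consumes 1, case_names zero single add]:
  fixes f :: "'a \<Rightarrow>\<^sub>0 'b::comm_monoid_add"
  assumes "Poly_Mapping.keys f \<subseteq> S" and z: "P 0"
    and s: "\<And>x c. x \<in> S \<Longrightarrow> P (Poly_Mapping.single x c)"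
    and a: "\<And>f g. Poly_Mapping.keys f \<subseteq> S \<Longrightarrow> Poly_Mapping.keys g \<subseteq> S \<Longrightarrow> P f \<Longrightarrow> P g \<Longrightarrow> P (f + g)"
  shows "P f"
proof -
  have eq: "f = (\<Sum>x\<in>Poly_Mapping.keys f. Poly_Mapping.single x (Poly_Mapping.lookup f x))"
  proof (rule poly_mapping_eqI)
    fix k
    have "(\<Sum>x\<in>Poly_Mapping.keys f. Poly_Mapping.lookup (Poly_Mapping.single x (Poly_Mapping.lookup f x)) k)
      = (\<Sum>x\<in>Poly_Mapping.keys f. if x = k then Poly_Mapping.lookup f k else 0)"
      by (rule sum.cong) (auto simp: lookup_single when_def)
    then show "Poly_Mapping.lookup f k = Poly_Mapping.lookup (\<Sum>x\<in>Poly_Mapping.keys f. Poly_Mapping.single x (Poly_Mapping.lookup f x)) k"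
      by (auto simp: lookup_sum in_keys_iff)
  qed
  have "finite I \<Longrightarrow> I \<subseteq> S \<Longrightarrow> P (\<Sum>x\<in>I. Poly_Mapping.single x (Poly_Mapping.lookup f x)) \<and> Poly_Mapping.keys (\<Sum>x\<in>I. Poly_Mapping.single x (Poly_Mapping.lookup f x)) \<subseteq> S" for I
  proof (induction I rule: finite_induct)
    case (insert x K)
    have k: "Poly_Mapping.keys (Poly_Mapping.single x (Poly_Mapping.lookup f x)) \<subseteq> S" using insert by auto
    have "P (Poly_Mapping.single x (Poly_Mapping.lookup f x) + (\<Sum>x\<in>K. Poly_Mapping.single x (Poly_Mapping.lookup f x)))"
      by (rule a) (use insert k s in auto)
    moreover have "Poly_Mapping.keys (Poly_Mapping.single x (Poly_Mapping.lookup f x) + (\<Sum>x\<in>K. Poly_Mapping.single x (Poly_Mapping.lookup f x))) \<subseteq> S"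
      by (rule order_trans[OF keys_add]) (use insert k in auto)
    ultimately show ?case using insert by simp
  qed (auto simp: z)
  from this[OF _ assms(1)] eq show ?thesis by simp
qed

locale inv_monoid = monoid M for M (structure) +
  fixes \<sigma> assumes sc: "x \<in> carrier M \<Longrightarrow> \<sigma> x \<in> carrier M"
    and ss: "x \<in> carrier M \<Longrightarrow> \<sigma> (\<sigma> x) = x"
    and sm: "x \<in> carrier M \<Longrightarrow> y \<in> carrier M \<Longrightarrow> \<sigma> (x \<otimes> y) = \<sigma> y \<otimes> \<sigma> x"

context fixes M :: "('m,'r) monoid_scheme" (structure) and \<sigma> :: "'m \<Rightarrow> 'm" begin

abbreviation (input) "msa \<equiv> monoid_star_algebra M \<sigma>"

lemma msa_add: "f \<oplus>\<^bsub>msa\<^esub> g = f + g" and msa_zero: "\<zero>\<^bsub>msa\<^esub> = 0" 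
  and msa_one: "\<one>\<^bsub>msa\<^esub> = Poly_Mapping.single \<one> 1"
  and msa_carrier: "carrier msa = {f. Poly_Mapping.keys f \<subseteq> carrier M}"
  by (simp_all add: monoid_star_algebra_def)

lemma msa_mult_addl: "(f + f') \<otimes>\<^bsub>msa\<^esub> g = f \<otimes>\<^bsub>msa\<^esub> g + f' \<otimes>\<^bsub>msa\<^esub> g"
  unfolding monoid_star_algebra_def apply simp
  by (rule setsum_keys_plus_distrib) (auto simp: algebra_simps single_add sum.distrib)

lemma msa_mult_addr: "g \<otimes>\<^bsub>msa\<^esub> (f + f') = g \<otimes>\<^bsub>msa\<^esub> f + g \<otimes>\<^bsub>msa\<^esub> f'"
  unfolding monoid_star_algebra_def apply (simp add: sum.distrib[symmetric])
  by (rule sum.cong[OF refl], rule setsum_keys_plus_distrib) (auto simp: algebra_simps single_add sum.distrib)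

lemma msa_mult_single: "Poly_Mapping.single x a \<otimes>\<^bsub>msa\<^esub> Poly_Mapping.single y b = Poly_Mapping.single (x \<otimes> y) (a * b)"
  unfolding monoid_star_algebra_def by (auto)

lemma msa_mult_0l: "0 \<otimes>\<^bsub>msa\<^esub> g = 0" and msa_mult_0r: "g \<otimes>\<^bsub>msa\<^esub> 0 = 0"
  unfolding monoid_star_algebra_def by (auto)

lemma msa_star_add: "star msa (f + g) = star msa f + star msa g"
  unfolding monoid_star_algebra_def apply simp
  by (rule setsum_keys_plus_distrib) (auto simp: algebra_simps single_add sum.distrib)

lemma msa_star_single: "star msa (Poly_Mapping.single x a) = Poly_Mapping.single (\<sigma> x) (cnj a)"
  unfolding monoid_star_algebra_def by (auto)

lemma msa_star_0: "star msa 0 = 0" 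
  unfolding monoid_star_algebra_def by (auto)

lemma msa_smult_lookup: "Poly_Mapping.lookup (c \<odot>\<^bsub>msa\<^esub> f) x = c * Poly_Mapping.lookup f x"
  unfolding monoid_star_algebra_def by (simp add: map.rep_eq when_def)

lemma msa_smult_add: "c \<odot>\<^bsub>msa\<^esub> (f + g) = c \<odot>\<^bsub>msa\<^esub> f + c \<odot>\<^bsub>msa\<^esub> g"
  by (auto intro!: poly_mapping_eqI simp: lookup_add msa_smult_lookup algebra_simps)

lemma msa_smult_addl: "(c+d) \<odot>\<^bsub>msa\<^esub> f = c \<odot>\<^bsub>msa\<^esub> f + d \<odot>\<^bsub>msa\<^esub> f"
  unfolding monoid_star_algebra_def by (auto intro!: poly_mapping_eqI simp: lookup_add map.rep_eq when_def algebra_simps)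

lemma msa_smult_mul: "(c*d) \<odot>\<^bsub>msa\<^esub> f = c \<odot>\<^bsub>msa\<^esub> (d \<odot>\<^bsub>msa\<^esub> f)"
  unfolding monoid_star_algebra_def by (auto intro!: poly_mapping_eqI simp: lookup_add map.rep_eq when_def algebra_simps)

lemma msa_smult_one: "1 \<odot>\<^bsub>msa\<^esub> f = f"
  unfolding monoid_star_algebra_def by (auto intro!: poly_mapping_eqI simp: lookup_add map.rep_eq when_def algebra_simps)

lemma msa_smult_single: "c \<odot>\<^bsub>msa\<^esub> Poly_Mapping.single x a = Poly_Mapping.single x (c * a)"
  unfolding monoid_star_algebra_def by simp

lemma msa_smult_0: "c \<odot>\<^bsub>msa\<^esub> 0 = 0"
  unfolding monoid_star_algebra_def by (auto intro!: poly_mapping_eqI simp: lookup_add map.rep_eq when_def algebra_simps)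

lemmas msa_simps = msa_add msa_zero msa_one msa_mult_addl msa_mult_addr msa_mult_single msa_mult_0l msa_mult_0r
  msa_star_add msa_star_single msa_star_0 msa_smult_add msa_smult_single msa_smult_0
end

lemma keys_addI: "Poly_Mapping.keys f \<subseteq> S \<Longrightarrow> Poly_Mapping.keys g \<subseteq> S \<Longrightarrow> Poly_Mapping.keys (f + g) \<subseteq> S"
  using keys_add by fastforce

lemma (in inv_monoid) msa_star_algebra: "star_algebra (monoid_star_algebra M \<sigma>)"
proof -
  let ?A = "monoid_star_algebra M \<sigma>"
  note [simp] = msa_carrier msa_simps
  have mc: "Poly_Mapping.keys (f \<otimes>\<^bsub>?A\<^esub> g) \<subseteq> carrier M" if "Poly_Mapping.keys f \<subseteq> carrier M" "Poly_Mapping.keys g \<subseteq> carrier M" for f g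
    using that(1)
  proof (induction f rule: poly_mapping_induct_on)
    case (single x c)
    show ?case using that(2) 
      by (induction g rule: poly_mapping_induct_on) (auto dest!: subsetD[OF keys_add] simp: single)
  qed (auto dest!: subsetD[OF keys_add])
  have stc: "Poly_Mapping.keys (star ?A f) \<subseteq> carrier M" if "Poly_Mapping.keys f \<subseteq> carrier M" for f
    using that by (induction f rule: poly_mapping_induct_on) (auto dest!: subsetD[OF keys_add] simp: sc split: if_splits)
  have smc: "Poly_Mapping.keys (c \<odot>\<^bsub>?A\<^esub> f) \<subseteq> carrier M" if "Poly_Mapping.keys f \<subseteq> carrier M" for f c
    using that by (induction f rule: poly_mapping_induct_on) (auto dest!: subsetD[OF keys_add] split: if_splits)
  have assoc: "f \<otimes>\<^bsub>?A\<^esub> g \<otimes>\<^bsub>?A\<^esub> h = f \<otimes>\<^bsub>?A\<^esub> (g \<otimes>\<^bsub>?A\<^esub> h)" if "Poly_Mapping.keys f \<subseteq> carrier M" "Poly_Mapping.keys g \<subseteq> carrier M" "Poly_Mapping.keys h \<subseteq> carrier M" for f g h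
    using that(1)
  proof (induction f rule: poly_mapping_induct_on)
    case (single x a)
    note x = this
    show ?case using that(2)
    proof (induction g rule: poly_mapping_induct_on)
      case (single y b)
      show ?case using that(3)
        by (induction h rule: poly_mapping_induct_on) (auto simp: x single m_assoc mult.assoc)
    qed auto
  qed auto
  have ab: "abelian_group ?A"
  proof (rule abelian_groupI)
    fix x assume "x \<in> carrier ?A" then show "\<exists>y\<in>carrier ?A. y \<oplus>\<^bsub>?A\<^esub> x = \<zero>\<^bsub>?A\<^esub>"
      by (auto intro!: exI[of _ "-x"])
  qed (auto simp: algebra_simps intro!: keys_addI dest: subsetD[OF keys_add])
  have mon: "monoid ?A"
  proof (rule monoidI)
    fix f assume "f \<in> carrier ?A" then have "Poly_Mapping.keys f \<subseteq> carrier M" by simp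
    then show "\<one>\<^bsub>?A\<^esub> \<otimes>\<^bsub>?A\<^esub> f = f" "f \<otimes>\<^bsub>?A\<^esub> \<one>\<^bsub>?A\<^esub> = f"
      by (induction f rule: poly_mapping_induct_on; auto)+
  qed (use mc assoc in auto)
  have ring: "ring ?A"
    by (rule ringI[OF ab mon]) auto
  have module: "module \<complex> ?A"
    by (rule moduleI[OF cring_complex_ring ab]) (use smc in \<open>auto simp: msa_smult_addl msa_smult_mul msa_smult_one\<close>)
  show ?thesis
  proof (intro star_algebra.intro module ring star_algebra_axioms.intro)
    fix x y c assume "x \<in> carrier ?A" "y \<in> carrier ?A"
    then have x: "Poly_Mapping.keys x \<subseteq> carrier M" and y: "Poly_Mapping.keys y \<subseteq> carrier M" by auto
    show "c \<odot>\<^bsub>?A\<^esub> x \<otimes>\<^bsub>?A\<^esub> y = c \<odot>\<^bsub>?A\<^esub> (x \<otimes>\<^bsub>?A\<^esub> y)" using x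
    proof (induction x rule: poly_mapping_induct_on)
      case (single x a) show ?case using y by (induction y rule: poly_mapping_induct_on) (auto simp: algebra_simps)
    qed auto
    show "x \<otimes>\<^bsub>?A\<^esub> (c \<odot>\<^bsub>?A\<^esub> y) = c \<odot>\<^bsub>?A\<^esub> (x \<otimes>\<^bsub>?A\<^esub> y)" using x
    proof (induction x rule: poly_mapping_induct_on)
      case (single x a) show ?case using y by (induction y rule: poly_mapping_induct_on) (auto simp: algebra_simps)
    qed auto
    show "star ?A (x \<otimes>\<^bsub>?A\<^esub> y) = star ?A y \<otimes>\<^bsub>?A\<^esub> star ?A x" using x
    proof (induction x rule: poly_mapping_induct_on)
      case (single x a) show ?case using y by (induction y rule: poly_mapping_induct_on) (auto simp: algebra_simps sm single)
    qed auto
  next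
    fix x c assume "x \<in> carrier ?A"
    then have x: "Poly_Mapping.keys x \<subseteq> carrier M" by auto
    show "star ?A (star ?A x) = x" using x by (induction x rule: poly_mapping_induct_on) (auto simp: ss)
    show "star ?A (c \<odot>\<^bsub>?A\<^esub> x) = cnj c \<odot>\<^bsub>?A\<^esub> star ?A x" using x
      by (induction x rule: poly_mapping_induct_on) (auto simp: ss)
  qed (use stc in auto)
qed

lemma free_star_algebra: "star_algebra (free_star_algebra :: (('g \<times> bool) list \<Rightarrow>\<^sub>0 complex) star_algebra)"
proof -
  interpret inv_monoid "\<lparr>carrier = UNIV, mult = (@), one = []\<rparr> :: ('g \<times> bool) list monoid" "\<lambda>w. rev (map (apsnd Not) w)"
    by unfold_locales (auto simp: rev_map comp_def apsnd_def map_prod_def split_beta)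
  show ?thesis unfolding free_star_algebra_def by (rule msa_star_algebra)
qed

lemma O_U1: "star_algebra O_U1"
proof -
  interpret inv_monoid integer_group uminus
    by unfold_locales (auto simp: integer_group_def)
  show ?thesis unfolding O_U1_def by (rule msa_star_algebra)
qed

lemma (in star_algebra) one_smult: "x \<in> carrier A \<Longrightarrow> 1 \<odot> x = x"
  using smult_one by (metis complex_ring_simps(4))

lemma (in star_algebra) star_zero: "star A \<zero> = \<zero>"
  using star_smult[of \<zero> 0] star_closed smult_l_null by fastforce

lemma (in star_algebra) star_one: "star A \<one> = \<one>"
proof -
  have "star A (star A \<one>) = star A (star A \<one> \<otimes> \<one>)" by (simp add: star_closed)
  also have "\<dots> = star A \<one> \<otimes> star A (star A \<one>)" by (rule star_mult) (auto simp: star_closed)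
  finally show ?thesis by (simp add: star_closed star_star)
qed

lemma pair_star_algebra:
  assumes "star_algebra A" "star_algebra B" shows "star_algebra (pair_algebra A B)"
proof -
  interpret A: star_algebra A by fact
  interpret B: star_algebra B by fact
  interpret monoid "A \<times>\<times> B" by (intro DirProd_monoid A.monoid_axioms B.monoid_axioms)
  interpret inv_monoid "A \<times>\<times> B" "map_prod (star A) (star B)"
    by unfold_locales (auto simp: A.star_closed B.star_closed A.star_star B.star_star A.star_mult B.star_mult)
  show ?thesis unfolding pair_algebra_def by (rule msa_star_algebra)
qed

lemma (in star_algebra) ideal_smult: "ideal J A \<Longrightarrow> x \<in> J \<Longrightarrow> c \<odot> x \<in> J"
proof -
  assume J: "ideal J A" and x: "x \<in> J"
  then interpret ideal J A by simp
  have xc: "x \<in> carrier A" using x a_subset by auto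
  have "c \<odot> x = (c \<odot> \<one>) \<otimes> x" using smult_mult_left[of \<one> x c] xc by simp
  also have "\<dots> \<in> J" by (rule I_l_closed[OF x]) simp
  finally show ?thesis .
qed

context star_algebra begin

lemma quot_star:
  assumes "star_ideal J A" "x \<in> carrier A"
  shows "star (star_quotient A J) (J +> x) = J +> star A x"
proof -
  interpret ideal J A using assms(1) by (simp add: star_ideal_def)
  have "J +> star A y = J +> star A x" if yJ: "y \<in> J +> x" for y
  proof -
    obtain j where j: "j \<in> J" "y = j \<oplus> x" using yJ by (auto simp: a_r_coset_def r_coset_def)
    then have "star A y \<in> J +> star A x" using assms a_subset unfolding a_r_coset_def r_coset_def star_ideal_def
      by (auto simp: star_add subset_iff)
    then show ?thesis by (metis a_repr_independence' assms(2) star_closed)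
  qed
  moreover have "x \<in> J +> x" using assms(2) by (rule a_rcos_self)
  ultimately have "(\<Union>y\<in>J +> x. J +> star A y) = J +> star A x" by (intro UN_constant_eq ballI) blast+
  then show ?thesis by (simp add: star_quotient_def)
qed

lemma quot_smult: assumes "ideal J A" "x \<in> carrier A"
  shows "c \<odot>\<^bsub>star_quotient A J\<^esub> (J +> x) = J +> (c \<odot> x)"
proof -
  interpret ideal J A using assms(1) by (simp add: star_ideal_def)
  have "J +> (c \<odot> y) = J +> (c \<odot> x)" if yJ: "y \<in> J +> x" for y
  proof -
    obtain j where j: "j \<in> J" "y = j \<oplus> x" using yJ by (auto simp: a_r_coset_def r_coset_def)
    have "j \<in> carrier A" using j a_subset by auto
    then have "c \<odot> y \<in> J +> (c \<odot> x)" using assms j ideal_smult[OF assms(1) j(1)] unfolding a_r_coset_def r_coset_def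
      by (auto simp: smult_r_distr)
    then show ?thesis by (metis a_repr_independence' assms(2) smult_closed complex_ring_simps(1) UNIV_I)
  qed
  moreover have "x \<in> J +> x" using assms(2) by (rule a_rcos_self)
  ultimately have "(\<Union>y\<in>J +> x. J +> (c \<odot> y)) = J +> (c \<odot> x)" by (intro UN_constant_eq ballI) blast+
  then show ?thesis by (simp add: star_quotient_def)
qed

lemma quot_simps: assumes "ideal J A" "x \<in> carrier A" "y \<in> carrier A"
  shows "(J +> x) \<otimes>\<^bsub>star_quotient A J\<^esub> (J +> y) = J +> (x \<otimes> y)"
   "(J +> x) \<oplus>\<^bsub>star_quotient A J\<^esub> (J +> y) = J +> (x \<oplus> y)"
   "\<one>\<^bsub>star_quotient A J\<^esub> = J +> \<one>"
   "\<zero>\<^bsub>star_quotient A J\<^esub> = J +> \<zero>"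
proof -
  interpret ideal J A using assms(1) .
  show "(J +> x) \<otimes>\<^bsub>star_quotient A J\<^esub> (J +> y) = J +> (x \<otimes> y)"
   "(J +> x) \<oplus>\<^bsub>star_quotient A J\<^esub> (J +> y) = J +> (x \<oplus> y)"
   "\<one>\<^bsub>star_quotient A J\<^esub> = J +> \<one>"
   "\<zero>\<^bsub>star_quotient A J\<^esub> = J +> \<zero>"
    using rcoset_mult_add[OF assms(2,3)] a_rcos_sum[OF assms(2,3)]
    by (auto simp: star_quotient_def FactRing_def a_coset_add_zero[OF a_subset])
qed

lemma quot_carrier: "carrier (star_quotient A J) = (\<lambda>x. J +> x) ` carrier A"
  by (auto simp: star_quotient_def FactRing_def A_RCOSETS_defs a_r_coset_def)

lemma quot_star_algebra: assumes "star_ideal J A" shows "star_algebra (star_quotient A J)"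
proof -
  have id: "ideal J A" using assms by (simp add: star_ideal_def)
  interpret ideal J A by fact
  have r: "ring (A Quot J)" by (rule quotient_is_ring)
  let ?Q = "star_quotient A J"
  interpret Q: ring "A Quot J" by fact
  have ab: "abelian_group ?Q"
  proof (rule abelian_groupI)
    fix x assume "x \<in> carrier ?Q"
    then have "\<ominus>\<^bsub>A Quot J\<^esub> x \<in> carrier ?Q" "\<ominus>\<^bsub>A Quot J\<^esub> x \<oplus>\<^bsub>?Q\<^esub> x = \<zero>\<^bsub>?Q\<^esub>"
      using Q.l_neg[of x] Q.a_inv_closed[of x] by (auto simp: star_quotient_def)
    then show "\<exists>y\<in>carrier ?Q. y \<oplus>\<^bsub>?Q\<^esub> x = \<zero>\<^bsub>?Q\<^esub>" by blast
  qed (use Q.a_assoc Q.a_comm Q.l_zero Q.a_closed Q.zero_closed in \<open>auto simp: star_quotient_def\<close>)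
  have mon: "monoid ?Q" by (rule monoidI) (simp_all add: star_quotient_def Q.m_assoc)
  have ring: "ring ?Q"
    by (rule ringI[OF ab mon]) (simp_all add: star_quotient_def Q.l_distr Q.r_distr)
  note q = quot_simps[OF id] quot_smult[OF id] quot_star[OF assms]
  have module: "module \<complex> ?Q"
    by (rule moduleI[OF cring_complex_ring ab]) (auto simp: quot_carrier q smult_l_distr[simplified] smult_r_distr smult_assoc1[simplified] one_smult)
  show ?thesis
    by (intro star_algebra.intro module ring star_algebra_axioms.intro)
      (auto simp: quot_carrier q star_closed smult_mult_left smult_mult_right star_star star_add star_smult star_mult)
qed

lemma genstarideal: assumes "S \<subseteq> carrier A" shows "star_ideal (genstarideal A S) A" "S \<subseteq> genstarideal A S"
proof -
  have c: "star_ideal (carrier A) A" using oneideal by (auto simp: star_ideal_def star_closed)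
  have "genstarideal A S = \<Inter>{J. star_ideal J A \<and> S \<subseteq> J}" by (simp add: genstarideal_def)
  have "ideal (\<Inter>{J. star_ideal J A \<and> S \<subseteq> J}) A"
    by (rule i_Intersect) (use c assms in \<open>auto simp: star_ideal_def\<close>)
  then show "star_ideal (genstarideal A S) A" by (auto simp: star_ideal_def genstarideal_def)
qed (auto simp: genstarideal_def)
end

lemma star_homD:
  assumes "h \<in> star_hom A B"
  shows "x \<in> carrier A \<Longrightarrow> h x \<in> carrier B"
    "x \<in> carrier A \<Longrightarrow> y \<in> carrier A \<Longrightarrow> h (x \<otimes>\<^bsub>A\<^esub> y) = h x \<otimes>\<^bsub>B\<^esub> h y"
    "x \<in> carrier A \<Longrightarrow> y \<in> carrier A \<Longrightarrow> h (x \<oplus>\<^bsub>A\<^esub> y) = h x \<oplus>\<^bsub>B\<^esub> h y"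
    "h \<one>\<^bsub>A\<^esub> = \<one>\<^bsub>B\<^esub>"
    "x \<in> carrier A \<Longrightarrow> h (c \<odot>\<^bsub>A\<^esub> x) = c \<odot>\<^bsub>B\<^esub> h x"
    "x \<in> carrier A \<Longrightarrow> h (star A x) = star B (h x)"
  using assms by (auto simp: star_hom_def ring_hom_def Pi_def)

abbreviation (input) "FSA \<equiv> free_star_algebra"

lemma FSA_carrier [simp]: "carrier FSA = UNIV" by (simp add: free_star_algebra_def msa_carrier)

lemmas FSA_simps = msa_simps[where M = "\<lparr>carrier = UNIV, mult = (@), one = []\<rparr>" and \<sigma> = "\<lambda>w. rev (map (apsnd Not) w)", folded free_star_algebra_def, simplified]

context star_algebra begin

definition letter where "letter \<phi> = (\<lambda>(g,b). if b then star A (\<phi> g) else \<phi> g)"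

definition ev_word where "ev_word \<phi> w = foldr (\<otimes>) (map (letter \<phi>) w) \<one>"

definition free_lift where "free_lift \<phi> f = (\<Oplus>w\<in>Poly_Mapping.keys f. Poly_Mapping.lookup f w \<odot> ev_word \<phi> w)"

context fixes \<phi> :: "'g \<Rightarrow> 'a" assumes p: "\<And>g. \<phi> g \<in> carrier A" begin

lemma letter_c: "letter \<phi> x \<in> carrier A" by (auto simp: letter_def p star_closed split: prod.splits)

lemma ev_word_c: "ev_word \<phi> w \<in> carrier A" by (induction w) (auto simp: ev_word_def letter_c)

lemma ev_word_app: "ev_word \<phi> (v @ w) = ev_word \<phi> v \<otimes> ev_word \<phi> w"
proof (induction v)
  case Nil then show ?case using ev_word_c by (simp add: ev_word_def)
next
  case (Cons a v)
  have "ev_word \<phi> (a # u) = letter \<phi> a \<otimes> ev_word \<phi> u" for u by (simp add: ev_word_def)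
  then show ?case using Cons by (simp add: m_assoc letter_c ev_word_c)
qed

lemma ev_word_star: "ev_word \<phi> (rev (map (apsnd Not) w)) = star A (ev_word \<phi> w)"
proof (induction w)
  case Nil then show ?case by (simp add: ev_word_def star_one)
next
  case (Cons a w)
  have "ev_word \<phi> (a # u) = letter \<phi> a \<otimes> ev_word \<phi> u" for u by (simp add: ev_word_def)
  moreover have "ev_word \<phi> [apsnd Not a] = star A (letter \<phi> a)"
    by (cases a) (auto simp: ev_word_def letter_def p star_closed star_star)
  ultimately show ?case using Cons by (simp add: ev_word_app letter_c ev_word_c star_mult)
qed

lemma free_lift_super: "finite K \<Longrightarrow> Poly_Mapping.keys f \<subseteq> K \<Longrightarrow> free_lift \<phi> f = (\<Oplus>w\<in>K. Poly_Mapping.lookup f w \<odot> ev_word \<phi> w)"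
  unfolding free_lift_def
  by (rule add.finprod_mono_neutral_cong_left) (use smult_l_null in \<open>auto simp: ev_word_c in_keys_iff\<close>)

lemma free_lift_c: "free_lift \<phi> f \<in> carrier A" unfolding free_lift_def by (rule finsum_closed) (auto simp: ev_word_c)

lemma free_lift_add: "free_lift \<phi> (f + g) = free_lift \<phi> f \<oplus> free_lift \<phi> g"
proof -
  let ?K = "Poly_Mapping.keys f \<union> Poly_Mapping.keys g"
  have "free_lift \<phi> (f + g) = (\<Oplus>w\<in>?K. (Poly_Mapping.lookup f w \<odot> ev_word \<phi> w) \<oplus> (Poly_Mapping.lookup g w \<odot> ev_word \<phi> w))"
    by (subst free_lift_super[of ?K]) (auto simp: keys_add lookup_add smult_l_distr[simplified] ev_word_c)
  also have "\<dots> = (\<Oplus>w\<in>?K. (Poly_Mapping.lookup f w \<odot> ev_word \<phi> w)) \<oplus> (\<Oplus>w\<in>?K. Poly_Mapping.lookup g w \<odot> ev_word \<phi> w)"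
    by (rule finsum_addf) (auto simp: ev_word_c)
  also have "\<dots> = free_lift \<phi> f \<oplus> free_lift \<phi> g" by (subst (1 2) free_lift_super[of ?K]) auto
  finally show ?thesis .
qed

lemma free_lift_single: "free_lift \<phi> (Poly_Mapping.single w c) = c \<odot> ev_word \<phi> w"
  using smult_l_null by (subst free_lift_super[of "{w}"]) (auto simp: ev_word_c)

lemma free_lift_0: "free_lift \<phi> 0 = \<zero>" by (simp add: free_lift_def)

lemma free_lift_hom: "free_lift \<phi> \<in> star_hom FSA A"
proof -
  have k: "Poly_Mapping.keys f \<subseteq> UNIV" for f :: "('g \<times> bool) list \<Rightarrow>\<^sub>0 complex" by simp
  note [simp] = FSA_simps free_lift_add free_lift_single free_lift_0 free_lift_c ev_word_c
  have m: "free_lift \<phi> (f \<otimes>\<^bsub>FSA\<^esub> g) = free_lift \<phi> f \<otimes> free_lift \<phi> g" for f g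
    using k[of f]
  proof (induction f rule: poly_mapping_induct_on)
    case (single x c)
    show ?case using k[of g]
      by (induction g rule: poly_mapping_induct_on) (auto simp: r_distr ev_word_app smult_mult_left smult_mult_right smult_assoc1[simplified, symmetric] mult.commute)
  qed (auto simp: l_distr)
  have s: "free_lift \<phi> (c \<odot>\<^bsub>FSA\<^esub> f) = c \<odot> free_lift \<phi> f" for f c
    using k[of f] smult_r_null by (induction f rule: poly_mapping_induct_on) (auto simp: smult_r_distr smult_assoc1[simplified])
  have st: "free_lift \<phi> (star FSA f) = star A (free_lift \<phi> f)" for f
    using k[of f] by (induction f rule: poly_mapping_induct_on) (auto simp: star_add star_zero ev_word_star star_smult)
  have o: "1 \<odot> ev_word \<phi> [] = \<one>" by (simp add: one_smult ev_word_def)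
  show ?thesis unfolding star_hom_def by (auto intro!: ring_hom_memI simp: m s st o)
qed

lemma free_lift_gen: "free_lift \<phi> (free_gen g) = \<phi> g"
  by (simp add: one_smult free_gen_def free_lift_single ev_word_def letter_def p)
end
end

lemma star_hom_zero:
  assumes "star_algebra A" "star_algebra B" "h \<in> star_hom A B" shows "h \<zero>\<^bsub>A\<^esub> = \<zero>\<^bsub>B\<^esub>"
proof -
  interpret A: star_algebra A by fact
  interpret B: star_algebra B by fact
  have "\<zero>\<^bsub>A\<^esub> = 0 \<odot>\<^bsub>A\<^esub> \<one>\<^bsub>A\<^esub>" using A.smult_l_null by simp
  then show ?thesis using star_homD[OF assms(3)] B.smult_l_null by (metis A.one_closed B.one_closed complex_ring_simps(5))
qed

lemma star_hom_minus:
  assumes "star_algebra A" "star_algebra B" "h \<in> star_hom A B" "x \<in> carrier A" "y \<in> carrier A"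
  shows "h (x \<ominus>\<^bsub>A\<^esub> y) = h x \<ominus>\<^bsub>B\<^esub> h y"
proof -
  interpret A: star_algebra A by fact
  interpret B: star_algebra B by fact
  note h = star_homD[OF assms(3)]
  have "h (\<ominus>\<^bsub>A\<^esub> y) \<oplus>\<^bsub>B\<^esub> h y = \<zero>\<^bsub>B\<^esub>"
    using h(3)[of "\<ominus>\<^bsub>A\<^esub> y" y] assms by (simp add: A.l_neg star_hom_zero)
  then have "h (\<ominus>\<^bsub>A\<^esub> y) = \<ominus>\<^bsub>B\<^esub> h y"
    using assms h(1) by (metis A.a_inv_closed B.minus_equality)
  then show ?thesis using h assms by (simp add: a_minus_def)
qed

lemma rel_ideal: "star_ideal (relation_ideal R) FSA" "(x,y) \<in> R \<Longrightarrow> x \<ominus>\<^bsub>FSA\<^esub> y \<in> relation_ideal R"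
  using star_algebra.genstarideal[OF free_star_algebra, of "{x \<ominus>\<^bsub>FSA\<^esub> y | x y. (x, y) \<in> R}"]
  by (auto simp: relation_ideal_def)

lemma presented_star_algebra: "star_algebra (presented_star_algebra R)"
  unfolding presented_star_algebra_def
  by (rule star_algebra.quot_star_algebra[OF free_star_algebra rel_ideal(1)])

lemma presented_lift:
  fixes \<phi> :: "'g \<Rightarrow> 'b" and B :: "('b,'n) star_algebra_scheme"
  assumes B: "star_algebra B" and \<phi>: "\<And>g. \<phi> g \<in> carrier B"
    and R: "\<And>x y \<Phi>. (x,y) \<in> R \<Longrightarrow> \<Phi> \<in> star_hom FSA B \<Longrightarrow> (\<And>g. \<Phi> (free_gen g) = \<phi> g) \<Longrightarrow> \<Phi> x = \<Phi> y"
  shows "\<exists>!\<rho>. \<rho> \<in> star_hom (presented_star_algebra R) B \<and> \<rho> \<in> extensional (carrier (presented_star_algebra R)) \<and> (\<forall>g. \<rho> (presented_gen R g) = \<phi> g)"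
proof -
  interpret B: star_algebra B by fact
  interpret F: star_algebra "FSA :: (('g \<times> bool) list \<Rightarrow>\<^sub>0 complex) star_algebra" by (rule free_star_algebra)
  define J where "J = relation_ideal R"
  define P where "P = presented_star_algebra R"
  have sJ: "star_ideal J FSA" unfolding J_def by (rule rel_ideal)
  then have iJ: "ideal J FSA" by (simp add: star_ideal_def)
  interpret J: ideal J FSA by fact
  have Pq: "P = star_quotient FSA J" by (simp add: P_def J_def presented_star_algebra_def)
  define \<Phi> where "\<Phi> = B.free_lift \<phi>"
  have \<Phi>: "\<Phi> \<in> star_hom FSA B" "\<Phi> (free_gen g) = \<phi> g" for g
    unfolding \<Phi>_def using B.free_lift_hom[of \<phi>, OF \<phi>] B.free_lift_gen[of \<phi>, OF \<phi>] by auto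
  note h = star_homD[OF \<Phi>(1), simplified]
  define K where "K = {x. \<Phi> x = \<zero>\<^bsub>B\<^esub>}"
  have hm: "\<Phi> (x \<ominus>\<^bsub>FSA\<^esub> y) = \<Phi> x \<ominus>\<^bsub>B\<^esub> \<Phi> y" for x y
    using star_hom_minus[OF free_star_algebra B \<Phi>(1)] by simp
  have h0: "\<Phi> \<zero>\<^bsub>FSA\<^esub> = \<zero>\<^bsub>B\<^esub>" using star_hom_zero[OF free_star_algebra B \<Phi>(1)] .
  have "ideal K FSA"
  proof (rule idealI)
    show "ring (FSA :: (('g \<times> bool) list \<Rightarrow>\<^sub>0 complex) star_algebra)" by (rule F.ring_axioms)
    show "subgroup K (add_monoid FSA)"
    proof (rule F.add.subgroupI)
      show "K \<noteq> {}" using h0 by (auto simp: K_def)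
      fix a assume "a \<in> K" then show "\<ominus>\<^bsub>FSA\<^esub> a \<in> K"
        using hm[of "\<zero>\<^bsub>FSA\<^esub>" a] by (simp add: K_def h0 a_minus_def)
    qed (auto simp: K_def h)
  qed (auto simp: K_def h)
  then have "star_ideal K FSA" by (auto simp: star_ideal_def K_def h B.star_zero)
  moreover have "{x \<ominus>\<^bsub>FSA\<^esub> y | x y. (x, y) \<in> R} \<subseteq> K"
  proof -
    have "\<Phi> x \<ominus>\<^bsub>B\<^esub> \<Phi> y = \<zero>\<^bsub>B\<^esub>" if "(x,y) \<in> R" for x y
      using R[OF that \<Phi>] h(1) by (simp add: B.r_neg a_minus_def)
    then show ?thesis by (auto simp: K_def hm)
  qed
  ultimately have JK: "J \<subseteq> K" by (auto simp: J_def relation_ideal_def genstarideal_def)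
  define \<rho> where "\<rho> = restrict (\<lambda>X. the_elem (\<Phi> ` X)) (carrier P)"
  have Pc: "carrier P = (\<lambda>x. J +>\<^bsub>FSA\<^esub> x) ` UNIV" unfolding Pq by (subst F.quot_carrier) simp
  have \<rho>: "\<rho> (J +>\<^bsub>FSA\<^esub> x) = \<Phi> x" for x
  proof -
    have "\<Phi> y = \<Phi> x" if yJ: "y \<in> J +>\<^bsub>FSA\<^esub> x" for y
    proof -
      obtain j where j: "j \<in> J" "y = j \<oplus>\<^bsub>FSA\<^esub> x" using yJ by (auto simp: a_r_coset_def r_coset_def)
      have "\<Phi> j = \<zero>\<^bsub>B\<^esub>" using j(1) JK by (auto simp: K_def)
      then show ?thesis using h(1,3) j(2) by simp
    qed
    moreover have "x \<in> J +>\<^bsub>FSA\<^esub> x" by (rule J.a_rcos_self) simp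
    ultimately have "\<Phi> ` (J +>\<^bsub>FSA\<^esub> x) \<subseteq> {\<Phi> x}" "\<Phi> x \<in> \<Phi> ` (J +>\<^bsub>FSA\<^esub> x)" by blast+
    then have "\<Phi> ` (J +>\<^bsub>FSA\<^esub> x) = {\<Phi> x}" by blast
    then show ?thesis by (simp add: \<rho>_def Pc)
  qed
  have q: "(J +>\<^bsub>FSA\<^esub> x) \<otimes>\<^bsub>P\<^esub> (J +>\<^bsub>FSA\<^esub> y) = J +>\<^bsub>FSA\<^esub> (x \<otimes>\<^bsub>FSA\<^esub> y)"
   "(J +>\<^bsub>FSA\<^esub> x) \<oplus>\<^bsub>P\<^esub> (J +>\<^bsub>FSA\<^esub> y) = J +>\<^bsub>FSA\<^esub> (x \<oplus>\<^bsub>FSA\<^esub> y)"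
   "\<one>\<^bsub>P\<^esub> = J +>\<^bsub>FSA\<^esub> \<one>\<^bsub>FSA\<^esub>" "c \<odot>\<^bsub>P\<^esub> (J +>\<^bsub>FSA\<^esub> x) = J +>\<^bsub>FSA\<^esub> (c \<odot>\<^bsub>FSA\<^esub> x)"
   "star P (J +>\<^bsub>FSA\<^esub> x) = J +>\<^bsub>FSA\<^esub> (star FSA x)" for x y c
    unfolding Pq using F.quot_simps[OF iJ] F.quot_smult[OF iJ] F.quot_star[OF sJ] by auto
  have gen: "presented_gen R g = J +>\<^bsub>FSA\<^esub> free_gen g" for g by (simp add: presented_gen_def J_def)
  have "\<rho> \<in> star_hom P B"
    unfolding star_hom_def by (auto intro!: ring_hom_memI simp: Pc q \<rho> h)
  moreover have "\<rho> \<in> extensional (carrier P)" by (simp add: \<rho>_def)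
  moreover have "\<rho> (presented_gen R g) = \<phi> g" for g by (simp add: gen \<rho> \<Phi>)
  moreover have "\<sigma> = \<rho>" if "\<sigma> \<in> star_hom P B" "\<sigma> \<in> extensional (carrier P)" "\<And>g. \<sigma> (presented_gen R g) = \<phi> g" for \<sigma>
  proof (rule extensionalityI[OF that(2)])
    show "\<rho> \<in> extensional (carrier P)" by (simp add: \<rho>_def)
    note s = star_homD[OF that(1)]
    define \<Psi> where "\<Psi> x = \<sigma> (J +>\<^bsub>FSA\<^esub> x)" for x
    have \<Psi>: "\<Psi> (x \<otimes>\<^bsub>FSA\<^esub> y) = \<Psi> x \<otimes>\<^bsub>B\<^esub> \<Psi> y" "\<Psi> (x \<oplus>\<^bsub>FSA\<^esub> y) = \<Psi> x \<oplus>\<^bsub>B\<^esub> \<Psi> y"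
      "\<Psi> \<one>\<^bsub>FSA\<^esub> = \<one>\<^bsub>B\<^esub>" "\<Psi> (c \<odot>\<^bsub>FSA\<^esub> x) = c \<odot>\<^bsub>B\<^esub> \<Psi> x" "\<Psi> (star FSA x) = star B (\<Psi> x)" "\<Psi> x \<in> carrier B" for x y c
      using s by (auto simp: \<Psi>_def q[symmetric] Pc)
    have w: "\<Psi> (Poly_Mapping.single w 1) = \<Phi> (Poly_Mapping.single w 1)" for w
    proof (induction w)
      case Nil then show ?case using h(4) \<Psi>(3) by (simp add: FSA_simps)
    next
      case (Cons a w)
      obtain g b where a: "a = (g,b)" by (cases a)
      have "star FSA (Poly_Mapping.single [(g,False)] 1) = Poly_Mapping.single [(g,True)] 1" by (simp add: FSA_simps)
      moreover have "\<Psi> (Poly_Mapping.single [(g,False)] 1) = \<Phi> (Poly_Mapping.single [(g,False)] 1)"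
        using \<Phi>(2)[of g] that(3)[of g] by (simp add: \<Psi>_def gen free_gen_def)
      ultimately have "\<Psi> (Poly_Mapping.single [a] 1) = \<Phi> (Poly_Mapping.single [a] 1)"
        using \<Psi>(5) h(6) a by (cases b) metis+
      then show ?case using \<Psi>(1)[of "Poly_Mapping.single [a] 1" "Poly_Mapping.single w 1"]
         h(2)[of "Poly_Mapping.single [a] 1" "Poly_Mapping.single w 1"] Cons by (simp add: FSA_simps)
    qed
    have "\<Psi> f = \<Phi> f" for f
    proof -
      have "Poly_Mapping.keys f \<subseteq> UNIV" by simp
      then show ?thesis
      proof (induction f rule: poly_mapping_induct_on)
        case zero
        have "(0 :: ('g \<times> bool) list \<Rightarrow>\<^sub>0 complex) = 0 \<odot>\<^bsub>FSA\<^esub> 0" by (simp add: FSA_simps)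
        then show ?case using \<Psi>(4)[of 0 0] h(5)[of 0 0] B.smult_l_null \<Psi>(6) h(1) by simp
      next
        case (single x c)
        have "Poly_Mapping.single x c = c \<odot>\<^bsub>FSA\<^esub> Poly_Mapping.single x 1" by (simp add: FSA_simps)
        then show ?case using \<Psi>(4) h(5) w by simp
      next
        case (add f g) then show ?case using \<Psi>(2)[of f g] h(3)[of f g] by (simp add: FSA_simps)
      qed
    qed
    then show "\<sigma> x = \<rho> x" if "x \<in> carrier P" for x using that by (auto simp: Pc \<rho> \<Psi>_def)
  qed
  ultimately show ?thesis unfolding P_def[symmetric] by blast
qed

locale star_algebra_pair = A: star_algebra A + B: star_algebra B for A :: "('a,'m) star_algebra_scheme" and B :: "('b,'n) star_algebra_scheme"
begin

abbreviation "T \<equiv> pair_algebra A B"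

abbreviation "N \<equiv> tensor_kernel A B"

sublocale T: star_algebra T by (rule pair_star_algebra) unfold_locales

lemmas T_simps = msa_simps[where M = "A \<times>\<times> B" and \<sigma> = "map_prod (star A) (star B)", folded pair_algebra_def]

lemma T_carrier: "carrier T = {f. Poly_Mapping.keys f \<subseteq> carrier A \<times> carrier B}"
  by (simp add: pair_algebra_def msa_carrier)

definition e where "e a b = Poly_Mapping.single (a,b) (1::complex)"

lemma e_c: "a \<in> carrier A \<Longrightarrow> b \<in> carrier B \<Longrightarrow> e a b \<in> carrier T" by (simp add: T_carrier e_def)

lemma T_uminus: "x \<in> carrier T \<Longrightarrow> \<ominus>\<^bsub>T\<^esub> x = - x"
  by (rule T.minus_equality) (auto simp: T_simps T_carrier)

lemma rel_c: "bilinear_relators A B \<subseteq> carrier T"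
  unfolding bilinear_relators_def Let_def T_carrier
  by (auto dest!: subsetD[OF keys_diff] split: if_splits)

lemma subm_add: assumes "submodule V \<complex> T" "x \<in> V" "y \<in> V" shows "x + y \<in> V"
  using T.submoduleE(5)[OF assms] by (simp add: T_simps)

lemma N_sub: "submodule N \<complex> T"
proof (rule T.submoduleI)
  have c: "submodule (carrier T) \<complex> T" by (rule T.carrier_is_submodule)
  let ?S = "{V. submodule V \<complex> T \<and> bilinear_relators A B \<subseteq> V}"
  have N: "N = \<Inter>?S" by (simp add: tensor_kernel_def)
  show "N \<subseteq> carrier T" using c rel_c by (auto simp: N)
  show "\<zero>\<^bsub>T\<^esub> \<in> N" unfolding N
    using submodule.axioms(1) subgroup.one_closed by (fastforce)
  fix a assume a: "a \<in> N" show "\<ominus>\<^bsub>T\<^esub> a \<in> N" using a T.submoduleE(3) unfolding N by blast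
  fix b assume b: "b \<in> N" show "a \<oplus>\<^bsub>T\<^esub> b \<in> N" using a b T.submoduleE(5) unfolding N by blast
next
  fix a x assume "a \<in> carrier \<complex>" "x \<in> N" then show "a \<odot>\<^bsub>T\<^esub> x \<in> N" 
    using T.submoduleE(4) unfolding tensor_kernel_def by blast
qed

lemma N_rel: "bilinear_relators A B \<subseteq> N" by (auto simp: tensor_kernel_def)

lemma N_min: "submodule V \<complex> T \<Longrightarrow> bilinear_relators A B \<subseteq> V \<Longrightarrow> N \<subseteq> V" by (auto simp: tensor_kernel_def)

lemmas N_closed = T.submoduleE[OF N_sub, simplified]

lemma bil: 
  "a \<in> carrier A \<Longrightarrow> a' \<in> carrier A \<Longrightarrow> b \<in> carrier B \<Longrightarrow> e (a \<oplus>\<^bsub>A\<^esub> a') b - e a b - e a' b \<in> bilinear_relators A B"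
  "a \<in> carrier A \<Longrightarrow> b \<in> carrier B \<Longrightarrow> b' \<in> carrier B \<Longrightarrow> e a (b \<oplus>\<^bsub>B\<^esub> b') - e a b - e a b' \<in> bilinear_relators A B"
  "a \<in> carrier A \<Longrightarrow> b \<in> carrier B \<Longrightarrow> e (c \<odot>\<^bsub>A\<^esub> a) b - c \<odot>\<^bsub>T\<^esub> e a b \<in> bilinear_relators A B"
  "a \<in> carrier A \<Longrightarrow> b \<in> carrier B \<Longrightarrow> e a (c \<odot>\<^bsub>B\<^esub> b) - c \<odot>\<^bsub>T\<^esub> e a b \<in> bilinear_relators A B"
  unfolding bilinear_relators_def e_def Let_def T_simps mult_1_right by blast+

lemma bil_cases:
  assumes "r \<in> bilinear_relators A B"
  obtains a a' b where "a \<in> carrier A" "a' \<in> carrier A" "b \<in> carrier B" "r = e (a \<oplus>\<^bsub>A\<^esub> a') b - e a b - e a' b"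
  | a b b' where "a \<in> carrier A" "b \<in> carrier B" "b' \<in> carrier B" "r = e a (b \<oplus>\<^bsub>B\<^esub> b') - e a b - e a b'"
  | c a b where "a \<in> carrier A" "b \<in> carrier B" "r = e (c \<odot>\<^bsub>A\<^esub> a) b - c \<odot>\<^bsub>T\<^esub> e a b"
  | c a b where "a \<in> carrier A" "b \<in> carrier B" "r = e a (c \<odot>\<^bsub>B\<^esub> b) - c \<odot>\<^bsub>T\<^esub> e a b"
proof -
  let ?S1 = "{e (a \<oplus>\<^bsub>A\<^esub> a') b - e a b - e a' b | a a' b. a \<in> carrier A \<and> a' \<in> carrier A \<and> b \<in> carrier B}"
  let ?S2 = "{e a (b \<oplus>\<^bsub>B\<^esub> b') - e a b - e a b' | a b b'. a \<in> carrier A \<and> b \<in> carrier B \<and> b' \<in> carrier B}"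
  let ?S3 = "{e (c \<odot>\<^bsub>A\<^esub> a) b - c \<odot>\<^bsub>T\<^esub> e a b | c a b. a \<in> carrier A \<and> b \<in> carrier B}"
  let ?S4 = "{e a (c \<odot>\<^bsub>B\<^esub> b) - c \<odot>\<^bsub>T\<^esub> e a b | c a b. a \<in> carrier A \<and> b \<in> carrier B}"
  have "bilinear_relators A B = ?S1 \<union> ?S2 \<union> ?S3 \<union> ?S4"
    unfolding bilinear_relators_def Let_def e_def T_simps mult_1_right by (rule refl)
  with assms consider "r \<in> ?S1" | "r \<in> ?S2" | "r \<in> ?S3" | "r \<in> ?S4" by blast
  then show thesis
  proof cases
    case 1 then show thesis using that(1) by (elim CollectE exE conjE) metis
  next
    case 2 then show thesis using that(2) by (elim CollectE exE conjE) metis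
  next
    case 3 then show thesis using that(3) by (elim CollectE exE conjE) metis
  next
    case 4 then show thesis using that(4) by (elim CollectE exE conjE) metis
  qed
qed

lemma T_diff: "(x - y) \<otimes>\<^bsub>T\<^esub> z = x \<otimes>\<^bsub>T\<^esub> z - y \<otimes>\<^bsub>T\<^esub> z" "z \<otimes>\<^bsub>T\<^esub> (x - y) = z \<otimes>\<^bsub>T\<^esub> x - z \<otimes>\<^bsub>T\<^esub> y"
  "star T (x - y) = star T x - star T y"
  using msa_mult_addl[of "A \<times>\<times> B" "map_prod (star A) (star B)" "x - y" y z] msa_mult_addr[of "A \<times>\<times> B" "map_prod (star A) (star B)" z "x - y" y]
    msa_star_add[of "A \<times>\<times> B" "map_prod (star A) (star B)" "x - y" y] by (simp_all add: pair_algebra_def eq_diff_eq)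

lemma e_mult: "e a b \<otimes>\<^bsub>T\<^esub> e a' b' = e (a \<otimes>\<^bsub>A\<^esub> a') (b \<otimes>\<^bsub>B\<^esub> b')" by (simp add: e_def T_simps)

lemma e_star: "star T (e a b) = e (star A a) (star B b)" by (simp add: e_def T_simps)

lemma rel_mult:
  assumes r: "r \<in> bilinear_relators A B" and x: "x \<in> carrier A" and y: "y \<in> carrier B"
  shows "r \<otimes>\<^bsub>T\<^esub> e x y \<in> bilinear_relators A B" "e x y \<otimes>\<^bsub>T\<^esub> r \<in> bilinear_relators A B"
  using r x y
  by (cases rule: bil_cases; use x y in \<open>simp add: T_diff e_mult T.smult_mult_left T.smult_mult_right e_c
   A.l_distr B.l_distr A.r_distr B.r_distr bil A.smult_mult_left A.smult_mult_right B.smult_mult_left B.smult_mult_right\<close>)+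

lemma rel_star:
  assumes r: "r \<in> bilinear_relators A B"
  shows "star T r \<in> bilinear_relators A B"
  using r
  by (cases rule: bil_cases) (auto simp: T_diff e_star T.star_smult e_c A.star_add B.star_add A.star_closed B.star_closed bil A.star_smult B.star_smult)

lemma N_mult: assumes n: "n \<in> N" and y: "y \<in> carrier T" shows "n \<otimes>\<^bsub>T\<^esub> y \<in> N \<and> y \<otimes>\<^bsub>T\<^esub> n \<in> N"
proof -
  define V where "V = {n \<in> carrier T. \<forall>y\<in>carrier T. n \<otimes>\<^bsub>T\<^esub> y \<in> N \<and> y \<otimes>\<^bsub>T\<^esub> n \<in> N}"
  have "submodule V \<complex> T"
    by (rule T.submoduleI) (use N_closed in \<open>auto simp: V_def T.l_distr T.r_distr T.smult_mult_left T.smult_mult_right T.l_minus T.r_minus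
       intro: subgroup.one_closed[OF submodule.axioms(1)[OF N_sub], simplified]\<close>)
  moreover have "bilinear_relators A B \<subseteq> V"
  proof
    fix r assume r: "r \<in> bilinear_relators A B"
    have "r \<otimes>\<^bsub>T\<^esub> y \<in> N \<and> y \<otimes>\<^bsub>T\<^esub> r \<in> N" if "y \<in> carrier T" for y
    proof -
      have "Poly_Mapping.keys y \<subseteq> carrier A \<times> carrier B" using that by (simp add: T_carrier)
      then show ?thesis
      proof (induction y rule: poly_mapping_induct_on)
        case zero then show ?case using subgroup.one_closed[OF submodule.axioms(1)[OF N_sub]] by (simp add: T_simps)
      next
        case (single p c)
        obtain a b where p: "p = (a,b)" "a \<in> carrier A" "b \<in> carrier B" using single by auto
        have q: "Poly_Mapping.single p c = c \<odot>\<^bsub>T\<^esub> e a b" by (simp add: e_def T_simps p)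
        have "r \<in> carrier T" using r rel_c by auto
        then show ?case unfolding q using rel_mult[OF r p(2,3)] N_rel N_closed(4) p
          by (simp add: T.smult_mult_left T.smult_mult_right e_c subset_iff)
      next
        case (add f g) then show ?case using N_closed(5) by (simp add: T_simps)
      qed
    qed
    then show "r \<in> V" using r rel_c by (auto simp: V_def)
  qed
  ultimately have "N \<subseteq> V" by (rule N_min)
  then show ?thesis using assms by (auto simp: V_def)
qed

lemma N_ideal: "star_ideal N T"
proof -
  have "ideal N T"
    by (rule idealI[OF T.ring_axioms submodule.axioms(1)[OF N_sub]]) (use N_mult in auto)
  moreover have "N \<subseteq> {n \<in> carrier T. star T n \<in> N}"
  proof (rule N_min)
    show "submodule {n \<in> carrier T. star T n \<in> N} \<complex> T"
    proof (rule T.submoduleI)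
      fix n assume n: "n \<in> {n \<in> carrier T. star T n \<in> N}"
      have "\<ominus>\<^bsub>T\<^esub> n = (-1) \<odot>\<^bsub>T\<^esub> n" if "n \<in> carrier T"
      proof (rule poly_mapping_eqI)
        fix k show "Poly_Mapping.lookup (\<ominus>\<^bsub>T\<^esub> n) k = Poly_Mapping.lookup ((-1) \<odot>\<^bsub>T\<^esub> n) k"
          using that by (simp add: T_uminus) (simp add: pair_algebra_def msa_smult_lookup)
      qed
      with n show "\<ominus>\<^bsub>T\<^esub> n \<in> {n \<in> carrier T. star T n \<in> N}" using N_closed(4) by (auto simp: T.star_smult)
    qed (use N_closed in \<open>auto simp: T.star_add T.star_smult T.star_zero intro: subgroup.one_closed[OF submodule.axioms(1)[OF N_sub], simplified]\<close>)
    show "bilinear_relators A B \<subseteq> {n \<in> carrier T. star T n \<in> N}" using rel_c rel_star N_rel by auto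
  qed
  ultimately show ?thesis by (auto simp: star_ideal_def)
qed

lemma tensor_star_algebra: "star_algebra (tensor_algebra A B)"
  unfolding tensor_algebra_def by (rule T.quot_star_algebra[OF N_ideal])

abbreviation "tt \<equiv> pure_tensor A B"

abbreviation "TT \<equiv> tensor_algebra A B"

lemma tt_def': "tt a b = N +>\<^bsub>T\<^esub> e a b" by (simp add: pure_tensor_def e_def)

lemma N_id: "ideal N T" using N_ideal by (simp add: star_ideal_def)

lemma tt:
  assumes "a \<in> carrier A" "b \<in> carrier B"
  shows "tt a b \<in> carrier TT" "star TT (tt a b) = tt (star A a) (star B b)" "c \<odot>\<^bsub>TT\<^esub> tt a b = tt (c \<odot>\<^bsub>A\<^esub> a) b"
   "a' \<in> carrier A \<Longrightarrow> b' \<in> carrier B \<Longrightarrow> tt a b \<otimes>\<^bsub>TT\<^esub> tt a' b' = tt (a \<otimes>\<^bsub>A\<^esub> a') (b \<otimes>\<^bsub>B\<^esub> b')"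
   "a' \<in> carrier A \<Longrightarrow> tt a b \<oplus>\<^bsub>TT\<^esub> tt a' b = tt (a \<oplus>\<^bsub>A\<^esub> a') b"
   "\<one>\<^bsub>TT\<^esub> = tt \<one>\<^bsub>A\<^esub> \<one>\<^bsub>B\<^esub>"
proof -
  note q = T.quot_simps[OF N_id] T.quot_smult[OF N_id] T.quot_star[OF N_ideal] T.quot_carrier
  have eq: "N +>\<^bsub>T\<^esub> x = N +>\<^bsub>T\<^esub> y" if "x - y \<in> N" "x \<in> carrier T" "y \<in> carrier T" for x y
    using T.quotient_eq_iff_same_a_r_cos[OF N_id that(2,3)] that by (simp add: a_minus_def T_uminus T_simps)
  show "tt a b \<in> carrier TT" "star TT (tt a b) = tt (star A a) (star B b)" 
    using assms by (auto simp: tt_def' tensor_algebra_def q e_c e_star)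
  have "e (c \<odot>\<^bsub>A\<^esub> a) b - c \<odot>\<^bsub>T\<^esub> e a b \<in> N" using bil(3) N_rel assms by blast
  from eq[OF this] show "c \<odot>\<^bsub>TT\<^esub> tt a b = tt (c \<odot>\<^bsub>A\<^esub> a) b"
    using assms by (simp add: tt_def' tensor_algebra_def q e_c)
  show "a' \<in> carrier A \<Longrightarrow> b' \<in> carrier B \<Longrightarrow> tt a b \<otimes>\<^bsub>TT\<^esub> tt a' b' = tt (a \<otimes>\<^bsub>A\<^esub> a') (b \<otimes>\<^bsub>B\<^esub> b')"
    using assms by (simp add: tt_def' tensor_algebra_def q e_c e_mult)
  show "tt a b \<oplus>\<^bsub>TT\<^esub> tt a' b = tt (a \<oplus>\<^bsub>A\<^esub> a') b" if "a' \<in> carrier A"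
  proof -
    have "e (a \<oplus>\<^bsub>A\<^esub> a') b - (e a b + e a' b) \<in> N" using bil(1)[of a a' b] N_rel assms that by (auto simp: diff_diff_eq)
    moreover have "e a b + e a' b \<in> carrier T" using T.a_closed[OF e_c e_c] assms that by (simp add: T_simps)
    ultimately show ?thesis using eq assms that by (simp add: tt_def' tensor_algebra_def q e_c T_simps)
  qed
  show "\<one>\<^bsub>TT\<^esub> = tt \<one>\<^bsub>A\<^esub> \<one>\<^bsub>B\<^esub>" using T.quot_simps(3)[OF N_id T.one_closed T.one_closed] by (simp add: tt_def' tensor_algebra_def T_simps e_def)
qed
end

lemma O_Sigma: "star_algebra (O_Sigma q)" unfolding O_Sigma_def by (rule presented_star_algebra)

lemma gen_c: "presented_gen R g \<in> carrier (presented_star_algebra R)"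
  unfolding presented_gen_def presented_star_algebra_def star_algebra.quot_carrier[OF free_star_algebra] by simp

lemma U_simps: "u_pow n \<in> carrier O_U1" "u_pow m \<otimes>\<^bsub>O_U1\<^esub> u_pow n = u_pow (m + n)" "\<one>\<^bsub>O_U1\<^esub> = u_pow 0"
  "star O_U1 (u_pow n) = u_pow (- n)"
  by (auto simp: O_U1_def u_pow_def msa_simps msa_carrier integer_group_def)

lemma pow2: assumes "monoid A" "x \<in> carrier A" shows "x [^]\<^bsub>A\<^esub> (2::nat) = x \<otimes>\<^bsub>A\<^esub> x"
proof -
  interpret monoid A by fact
  show ?thesis using assms(2) by (simp add: numeral_2_eq_2)
qed

lemma quot_rel: assumes "(x,y) \<in> R" 
  shows "relation_ideal R +>\<^bsub>FSA\<^esub> x = relation_ideal R +>\<^bsub>FSA\<^esub> y"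
proof -
  interpret F: star_algebra "FSA :: (('a \<times> bool) list \<Rightarrow>\<^sub>0 complex) star_algebra" by (rule free_star_algebra)
  show ?thesis using F.quotient_eq_iff_same_a_r_cos[of "relation_ideal R" x y] rel_ideal(1)[where R=R] rel_ideal(2)[OF assms] by (auto simp: star_ideal_def)
qed

lemma pi_hom: "(\<lambda>x. relation_ideal R +>\<^bsub>FSA\<^esub> x) \<in> star_hom FSA (presented_star_algebra R)"
proof -
  interpret F: star_algebra "FSA :: (('a \<times> bool) list \<Rightarrow>\<^sub>0 complex) star_algebra" by (rule free_star_algebra)
  have s: "star_ideal (relation_ideal R) FSA" by (rule rel_ideal)
  then have i: "ideal (relation_ideal R) FSA" by (simp add: star_ideal_def)
  show ?thesis unfolding star_hom_def presented_star_algebra_def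
    using F.quot_simps[OF i] F.quot_smult[OF i] F.quot_star[OF s]
    by (auto intro!: ring_hom_memI simp: F.quot_carrier)
qed

definition seifert_rels where "seifert_rels A q z0 z1 x \<longleftrightarrow> 
  x \<otimes>\<^bsub>A\<^esub> star A x = \<one>\<^bsub>A\<^esub> \<and> star A x \<otimes>\<^bsub>A\<^esub> x = \<one>\<^bsub>A\<^esub> \<and> x \<otimes>\<^bsub>A\<^esub> z0 = z0 \<otimes>\<^bsub>A\<^esub> x \<and> x \<otimes>\<^bsub>A\<^esub> z1 = z1 \<otimes>\<^bsub>A\<^esub> x \<and>
  z0 \<otimes>\<^bsub>A\<^esub> z1 = complex_of_real q \<odot>\<^bsub>A\<^esub> (z1 \<otimes>\<^bsub>A\<^esub> z0) \<and>
  z0 \<otimes>\<^bsub>A\<^esub> star A z0 = star A z0 \<otimes>\<^bsub>A\<^esub> z0 \<oplus>\<^bsub>A\<^esub> complex_of_real (q powi (-2) - 1) \<odot>\<^bsub>A\<^esub> (z1 \<otimes>\<^bsub>A\<^esub> z1 \<otimes>\<^bsub>A\<^esub> x) \<and>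
  z0 \<otimes>\<^bsub>A\<^esub> star A z0 \<oplus>\<^bsub>A\<^esub> z1 \<otimes>\<^bsub>A\<^esub> z1 \<otimes>\<^bsub>A\<^esub> x = \<one>\<^bsub>A\<^esub> \<and> star A z1 = z1 \<otimes>\<^bsub>A\<^esub> x"

lemma hom_rels:
  fixes B :: "('b,'n) star_algebra_scheme"
  assumes "h \<in> star_hom FSA B" "star_algebra B"
  shows "(\<forall>(x,y)\<in>seifert_relations q. h x = h y) \<longleftrightarrow> seifert_rels B q (h (free_gen Zeta0)) (h (free_gen Zeta1)) (h (free_gen Xi))"
proof -
  interpret B: star_algebra B by fact
  interpret F: star_algebra "FSA :: seifert_free star_algebra" by (rule free_star_algebra)
  note h = star_homD[OF assms(1), simplified]
  show ?thesis unfolding seifert_relations_def seifert_rels_def Let_def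
    using pow2[OF F.monoid_axioms] by (simp add: h)
qed

lemma Sigma_rels: "seifert_rels (O_Sigma q) q (zeta0 q) (zeta1 q) (xi q)"
  using hom_rels[where q=q, OF pi_hom[where R="seifert_relations q"] presented_star_algebra] quot_rel
  by (fastforce simp: zeta0_def zeta1_def xi_def O_Sigma_def presented_gen_def)

lemma coaction_ex1:
  "\<exists>!\<rho>. \<rho> \<in> star_hom (O_Sigma q) (tensor_algebra (O_Sigma q) O_U1) \<and>
       \<rho> \<in> extensional (carrier (O_Sigma q)) \<and>
       \<rho> (zeta0 q) = pure_tensor (O_Sigma q) O_U1 (zeta0 q) (u_pow k) \<and>
       \<rho> (zeta1 q) = pure_tensor (O_Sigma q) O_U1 (zeta1 q) (u_pow l) \<and>
       \<rho> (xi q) = pure_tensor (O_Sigma q) O_U1 (xi q) (u_pow (- 2 * l))"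
proof -
  interpret star_algebra_pair "O_Sigma q" O_U1 unfolding star_algebra_pair_def by (simp add: O_Sigma O_U1)
  have c: "zeta0 q \<in> carrier (O_Sigma q)" "zeta1 q \<in> carrier (O_Sigma q)" "xi q \<in> carrier (O_Sigma q)"
    by (simp_all add: zeta0_def zeta1_def xi_def O_Sigma_def gen_c)
  define \<phi> where "\<phi> = (\<lambda>g. case g of Zeta0 \<Rightarrow> tt (zeta0 q) (u_pow k) | Zeta1 \<Rightarrow> tt (zeta1 q) (u_pow l) | Xi \<Rightarrow> tt (xi q) (u_pow (- 2 * l)))"
  have T: "star_algebra TT" by (rule tensor_star_algebra)
  note [simp] = tt U_simps c A.star_closed B.star_closed
  have "seifert_rels TT q (\<phi> Zeta0) (\<phi> Zeta1) (\<phi> Xi)"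
  proof -
    define qq where "qq = complex_of_real (q powi (-2) - 1)"
    have one: "\<one>\<^bsub>TT\<^esub> = tt \<one>\<^bsub>O_Sigma q\<^esub> (u_pow 0)" using tt(6)[OF A.one_closed B.one_closed] by simp
    show ?thesis
      unfolding seifert_rels_def \<phi>_def qq_def[symmetric]
      apply (simp add: one)
      using Sigma_rels[of q, unfolded seifert_rels_def qq_def[symmetric]]
      apply (elim conjE)
      apply (intro conjI)
           apply (simp_all only: add.commute)
      done
  qed
  moreover have "\<phi> g \<in> carrier TT" for g by (cases g) (auto simp: \<phi>_def)
  ultimately have "\<exists>!\<rho>. \<rho> \<in> star_hom (presented_star_algebra (seifert_relations q)) TT \<and> \<rho> \<in> extensional (carrier (presented_star_algebra (seifert_relations q))) \<and> (\<forall>g. \<rho> (presented_gen (seifert_relations q) g) = \<phi> g)"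
    using hom_rels[where q=q, OF _ T] by (intro presented_lift[OF T]) fastforce+
  moreover have "(\<forall>g. P g) \<longleftrightarrow> P Zeta0 \<and> P Zeta1 \<and> P Xi" for P by (metis seifert_gen.exhaust)
  ultimately show ?thesis by (simp add: zeta0_def zeta1_def xi_def O_Sigma_def \<phi>_def)
qed

end

theory Submission
  imports Defs
begin

text \<open>
  The coaction is a grading of the algebra by the integers in which \<open>\<zeta>\<^sub>0\<close>, \<open>\<zeta>\<^sub>1\<close>, \<open>\<xi>\<close> have the
  degrees \<open>k\<close>, \<open>l\<close>, \<open>-2l\<close>, and the coinvariants are the part of degree \<open>0\<close>. The algebra is spanned
  by the monomials \<open>\<zeta>\<^sub>0\<^sup>m\<zeta>\<^sub>1\<^sup>p\<xi>\<^sup>r\<close> and \<open>\<zeta>\<^sub>0\<^sup>*\<^sup>m\<zeta>\<^sub>1\<^sup>p\<xi>\<^sup>r\<close> (\<open>carrier_monomial_span\<close>), all of them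
  homogeneous. The slice map \<open>id \<otimes> \<phi>\<close>, with \<open>\<phi>\<close> the constant coefficient of a Laurent
  polynomial, composed with the coaction fixes each coinvariant, and it keeps or kills each monomial
  according to its degree. Hence every coinvariant is a linear combination of monomials of degree
  \<open>0\<close> (\<open>coinvariants_subset\<close>).

  It remains to factor these monomials. The second family consists of scalar multiples of adjoints
  of members of the first, so let \<open>k m + l p = 2 l r\<close>. As \<open>l\<close> is coprime to \<open>k\<close>, it divides \<open>m\<close>, and
  with \<open>m = l n\<close> the number \<open>k n + p = 2 r\<close> is even. For even \<open>k\<close> this makes \<open>p\<close> even and the
  monomial is \<open>c\<^sub>+\<^sup>n a\<^sup>p\<^sup>/\<^sup>2\<close> (\<open>even_monomial\<close>). For odd \<open>k\<close> it makes \<open>n\<close> and \<open>p\<close> of equal parity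
  and the monomial is a product of powers of \<open>c\<^sub>-\<close> and \<open>a\<close>, with one extra factor \<open>b\<close> in the odd
  case, up to a power of \<open>q\<close> (\<open>odd_monomial\<close>).

  The relations follow by normal ordering: \<open>\<xi>\<close> is central and \<open>\<zeta>\<^sub>1\<close> commutes with \<open>\<zeta>\<^sub>0\<close> and
  \<open>\<zeta>\<^sub>0\<^sup>*\<close> up to powers of \<open>q\<close>. The products of factors \<open>1 - q\<^sup>2\<^sup>j a\<close> come from telescoping
  \<open>\<zeta>\<^sub>0\<^sup>n\<zeta>\<^sub>0\<^sup>*\<^sup>n\<close> and \<open>\<zeta>\<^sub>0\<^sup>*\<^sup>n\<zeta>\<^sub>0\<^sup>n\<close> with \<open>\<zeta>\<^sub>0\<zeta>\<^sub>0\<^sup>* = 1 - a\<close> and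
  \<open>\<zeta>\<^sub>0\<^sup>*\<zeta>\<^sub>0 = 1 - q\<^sup>-\<^sup>2 a\<close> (\<open>Z_Zs\<close> and \<open>Zs_Z\<close>).
\<close>

section \<open>Computing in star-algebras\<close>

context star_algebra begin

lemma smult_smult: "v \<in> carrier A \<Longrightarrow> c \<odot> (d \<odot> v) = (c * d) \<odot> v"
  by (simp add: smult_assoc1[simplified])

lemma uminus_eq_smult: "v \<in> carrier A \<Longrightarrow> \<ominus> v = (-1) \<odot> v"
proof -
  assume v: "v \<in> carrier A"
  have "(-1) \<odot> v \<oplus> v = (-1 + 1) \<odot> v"
    using v smult_l_distr[of "-1" 1 v] by (simp add: one_smult)
  also have "\<dots> = \<zero>" using v smult_l_null by simp
  finally show ?thesis using v by (intro minus_equality) auto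
qed

lemma smult_zero: "c \<odot> \<zero> = \<zero>"
  using smult_r_null by simp

lemma mult_minus_distr: "v \<in> carrier A \<Longrightarrow> w \<in> carrier A \<Longrightarrow> u \<in> carrier A \<Longrightarrow> u \<otimes> (v \<ominus> w) = u \<otimes> v \<ominus> u \<otimes> w"
  "v \<in> carrier A \<Longrightarrow> w \<in> carrier A \<Longrightarrow> u \<in> carrier A \<Longrightarrow> (v \<ominus> w) \<otimes> u = v \<otimes> u \<ominus> w \<otimes> u"
  by (simp_all add: a_minus_def l_distr r_distr l_minus r_minus)

lemma ordered_prod_empty: "ordered_prod A f i i = \<one>"
  by (simp add: ordered_prod_def)

lemma ordered_prod_Suc:
  assumes "i \<le> n" and f: "\<And>m. f m \<in> carrier A"
  shows "ordered_prod A f i (Suc n) = ordered_prod A f i n \<otimes> f n"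
proof -
  have "foldr (\<otimes>) (map f ms) e = foldr (\<otimes>) (map f ms) \<one> \<otimes> e \<and>
      foldr (\<otimes>) (map f ms) \<one> \<in> carrier A" if "e \<in> carrier A" for e ms
    using that f by (induction ms) (auto simp: m_assoc)
  from this[of "f n" "[i..<n]"] show ?thesis
    using assms by (simp add: ordered_prod_def)
qed

text \<open>
  Relations of the form \<open>u v = c v u\<close> give a terminating normal-ordering procedure for words in
  powers of the generators. For this they are needed for powers, where each exchange of two letters
  contributes one factor \<open>c\<close>, and in front of a further factor.
\<close>

lemma q_commute_pow_right:
  assumes "u \<in> carrier A" "v \<in> carrier A" "u \<otimes> v = c \<odot> (v \<otimes> u)"
  shows "u \<otimes> v [^] (n::nat) = (c ^ n) \<odot> (v [^] n \<otimes> u)"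
proof (induction n)
  case 0
  then show ?case using assms by (simp add: one_smult)
next
  case (Suc n)
  have "u \<otimes> v [^] Suc n = (c ^ n \<odot> (v [^] n \<otimes> u)) \<otimes> v"
    using assms Suc by (simp add: m_assoc[symmetric])
  also have "\<dots> = c ^ n \<odot> (v [^] n \<otimes> (u \<otimes> v))"
    using assms(1,2) by (simp add: smult_mult_left m_assoc)
  also have "\<dots> = c ^ Suc n \<odot> (v [^] Suc n \<otimes> u)"
    using assms by (simp add: smult_mult_right smult_smult m_assoc mult.commute)
  finally show ?case .
qed

lemma q_commute_pow_left:
  assumes "u \<in> carrier A" "v \<in> carrier A" "u \<otimes> v = c \<odot> (v \<otimes> u)"
  shows "u [^] (n::nat) \<otimes> v = (c ^ n) \<odot> (v \<otimes> u [^] n)"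
proof (induction n)
  case 0
  then show ?case using assms by (simp add: one_smult)
next
  case (Suc n)
  have "u [^] Suc n \<otimes> v = u [^] n \<otimes> (c \<odot> (v \<otimes> u))"
    using assms by (simp add: m_assoc)
  also have "\<dots> = c \<odot> ((u [^] n \<otimes> v) \<otimes> u)"
    using assms(1,2) by (simp add: smult_mult_right m_assoc)
  also have "\<dots> = c ^ Suc n \<odot> (v \<otimes> u [^] Suc n)"
    unfolding Suc using assms(1,2) by (simp add: smult_mult_left smult_smult m_assoc)
  finally show ?case .
qed

lemma q_commute_left:
  assumes "u \<in> carrier A" "v \<in> carrier A" "w \<in> carrier A" "u \<otimes> v = c \<odot> (v \<otimes> u)"
  shows "u \<otimes> (v \<otimes> w) = c \<odot> (v \<otimes> (u \<otimes> w))"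
  using assms smult_mult_left[of "v \<otimes> u" w c] by (simp add: m_assoc[symmetric])

lemma star_pow: "v \<in> carrier A \<Longrightarrow> star A (v [^] (n::nat)) = star A v [^] n"
proof (induction n)
  case (Suc n)
  then show ?case using nat_pow_Suc2[of "star A v" n] by (simp add: star_mult star_closed)
qed (simp add: star_one)

lemma star_subalgebraD:
  assumes "star_subalgebra B A"
  shows "\<one> \<in> B" "\<zero> \<in> B" "v \<in> B \<Longrightarrow> v \<in> carrier A" "v \<in> B \<Longrightarrow> w \<in> B \<Longrightarrow> v \<oplus> w \<in> B"
    "v \<in> B \<Longrightarrow> w \<in> B \<Longrightarrow> v \<otimes> w \<in> B" "v \<in> B \<Longrightarrow> c \<odot> v \<in> B" "v \<in> B \<Longrightarrow> star A v \<in> B"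
    "v \<in> B \<Longrightarrow> v [^] (n::nat) \<in> B"
proof -
  have s: "submodule B \<complex> A" using assms by (simp add: star_subalgebra_def)
  show m: "\<one> \<in> B" "v \<in> B \<Longrightarrow> w \<in> B \<Longrightarrow> v \<otimes> w \<in> B" "v \<in> B \<Longrightarrow> star A v \<in> B" for v w
    using assms by (auto simp: star_subalgebra_def)
  show "\<zero> \<in> B" using subgroup.one_closed[OF submodule.axioms(1)[OF s]] by simp
  show "v \<in> B \<Longrightarrow> v \<in> carrier A" "v \<in> B \<Longrightarrow> w \<in> B \<Longrightarrow> v \<oplus> w \<in> B" "v \<in> B \<Longrightarrow> c \<odot> v \<in> B"
    using submoduleE[OF s] by auto
  show "v \<in> B \<Longrightarrow> v [^] n \<in> B" by (induction n) (auto simp: m)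
qed

end

section \<open>Normal ordering in the quantum Seifert manifold\<close>

locale seifert = star_algebra A for A (structure) +
  fixes q :: real and z y x
  assumes q_nonzero: "q \<noteq> 0"
    and gen_closed: "z \<in> carrier A" "y \<in> carrier A" "x \<in> carrier A"
    and rels: "seifert_rels A q z y x"
begin

text \<open>
  The functions \<open>Z\<close>, \<open>Zs\<close>, \<open>Y\<close>, \<open>X\<close> stand for the powers of \<open>\<zeta>\<^sub>0\<close>, \<open>\<zeta>\<^sub>0\<^sup>*\<close>, \<open>\<zeta>\<^sub>1\<close>
  and \<open>\<xi>\<close>. They are opaque, so that a first power is not rewritten to the bare generator and the
  exponent laws apply to every factor of a word.
\<close>

definition Q :: "int \<Rightarrow> complex" where "Q n = complex_of_real (q powi n)"
definition Z :: "nat \<Rightarrow> 'a" where "Z n = z [^] n"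
definition Zs :: "nat \<Rightarrow> 'a" where "Zs n = star A z [^] n"
definition Y :: "nat \<Rightarrow> 'a" where "Y n = y [^] n"
definition X :: "int \<Rightarrow> 'a" where "X n = unitary_pow A x n"
definition a where "a = Y 2 \<otimes> X 1"

lemma Q_add: "Q m * Q n = Q (m + n)"
  using q_nonzero by (simp add: Q_def power_int_add del: of_real_power_int)

lemma Q_0: "Q 0 = 1" by (simp add: Q_def)
lemma Q_cnj: "cnj (Q n) = Q n" by (simp add: Q_def del: of_real_power_int)
lemma Q_power: "Q m ^ n = Q (m * int n)"
  by (induction n) (auto simp: Q_0 Q_add algebra_simps)

lemma closed [simp]:
  "z \<in> carrier A" "y \<in> carrier A" "x \<in> carrier A"
  "star A z \<in> carrier A" "star A y \<in> carrier A" "star A x \<in> carrier A"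
  "Z n \<in> carrier A" "Zs n \<in> carrier A" "Y n \<in> carrier A" "X r \<in> carrier A" "a \<in> carrier A"
proof -
  have X: "X r \<in> carrier A" for r
    unfolding X_def unitary_pow_def using gen_closed star_closed nat_pow_closed by metis
  show "z \<in> carrier A" "y \<in> carrier A" "x \<in> carrier A"
    "star A z \<in> carrier A" "star A y \<in> carrier A" "star A x \<in> carrier A"
    "Z n \<in> carrier A" "Zs n \<in> carrier A" "Y n \<in> carrier A" "X r \<in> carrier A" "a \<in> carrier A"
    using gen_closed X by (auto simp: Z_def Zs_def Y_def a_def star_closed)
qed

lemma unitary: "x \<otimes> star A x = \<one>" "star A x \<otimes> x = \<one>"
  using rels by (auto simp: seifert_rels_def)

lemma X_simps: "X 0 = \<one>" "X 1 = x" "X (-1) = star A x" "X (int n) = x [^] n" "X (- int n) = star A x [^] n"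
  by (auto simp: X_def unitary_pow_def)

lemma X_add_1: "X (r + 1) = X r \<otimes> x"
proof (cases "r \<ge> 0")
  case True
  then obtain n where "r = int n" by (metis nat_0_le)
  then have "r + 1 = int (Suc n)" by simp
  then show ?thesis using \<open>r = int n\<close> by (simp only: X_simps nat_pow_Suc)
next
  case False
  then obtain n where n: "r = - int (Suc n)" "r + 1 = - int n"
    by (metis int_cases add.commute add_minus_cancel minus_add_distrib not_le of_nat_Suc of_nat_0_le_iff)
  then show ?thesis by (simp only: X_simps nat_pow_Suc) (simp add: m_assoc unitary)
qed

lemma X_diff_1: "X (r - 1) = X r \<otimes> star A x"
  using X_add_1[of "r - 1"] by (simp add: m_assoc unitary)

lemma X_X: "X r \<otimes> X t = X (r + t)"
proof (induction t rule: int_induct[where k = 0])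
  case (step1 i)
  then show ?case by (simp add: X_add_1 m_assoc[symmetric] add.assoc[symmetric])
next
  case (step2 i)
  have "r + (i - 1) = (r + i) - 1" by simp
  then show ?case using step2 by (simp only: X_diff_1) (simp add: m_assoc[symmetric])
qed (simp add: X_simps)

lemma X_central:
  assumes u: "u \<in> carrier A" and c: "x \<otimes> u = u \<otimes> x"
  shows "X r \<otimes> u = u \<otimes> X r"
proof (induction r rule: int_induct[where k = 0])
  case (step1 i)
  then show ?case using u c by (simp add: X_add_1 m_assoc) (simp add: m_assoc[symmetric])
next
  case (step2 i)
  have "star A x \<otimes> u = star A x \<otimes> (u \<otimes> x) \<otimes> star A x"
    using u by (simp add: m_assoc unitary)
  also have "\<dots> = u \<otimes> star A x"
    using u by (simp add: c[symmetric]) (simp add: m_assoc[symmetric] unitary)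
  finally show ?case using u step2 by (simp add: X_diff_1 m_assoc) (simp add: m_assoc[symmetric])
qed (simp add: u X_simps)

lemma X_z: "X r \<otimes> z = z \<otimes> X r" and X_y: "X r \<otimes> y = y \<otimes> X r"
  using rels by (auto simp: seifert_rels_def intro!: X_central)

lemma X_star_z: "X r \<otimes> star A z = star A z \<otimes> X r"
  using X_z[of "-1"] star_mult[of z "star A x"] star_mult[of "star A x" z] 
  by (intro X_central) (auto simp: X_simps star_star)

lemma star_y: "star A y = y \<otimes> x" using rels by (simp add: seifert_rels_def)

lemma y_z: "y \<otimes> z = Q (-1) \<odot> (z \<otimes> y)"
proof -
  have "z \<otimes> y = Q 1 \<odot> (y \<otimes> z)" using rels by (simp add: seifert_rels_def Q_def)
  then show ?thesis by (simp add: smult_smult Q_add Q_0 one_smult)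
qed

text \<open>
  The adjoint of \<open>\<zeta>\<^sub>0\<zeta>\<^sub>1 = q\<zeta>\<^sub>1\<zeta>\<^sub>0\<close> relates \<open>\<zeta>\<^sub>0\<^sup>*\<close> to \<open>\<zeta>\<^sub>1\<^sup>* = \<zeta>\<^sub>1\<xi>\<close>; the central
  unitary \<open>\<xi>\<close> can then be cancelled.
\<close>

lemma y_star_z: "y \<otimes> star A z = Q 1 \<odot> (star A z \<otimes> y)"
proof -
  have *: "z \<otimes> y = Q 1 \<odot> (y \<otimes> z)" using rels by (simp add: seifert_rels_def Q_def)
  have "(y \<otimes> x) \<otimes> star A z = Q 1 \<odot> (star A z \<otimes> (y \<otimes> x))"
    using star_mult[of z y] star_mult[of y z] star_smult[of "y \<otimes> z" "Q 1"] * by (simp add: star_y Q_cnj)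
  then have "(y \<otimes> star A z) \<otimes> x = (Q 1 \<odot> (star A z \<otimes> y)) \<otimes> x"
    using X_star_z[of 1] by (simp add: X_simps m_assoc smult_mult_left)
  then have "(y \<otimes> star A z) \<otimes> (x \<otimes> star A x) = (Q 1 \<odot> (star A z \<otimes> y)) \<otimes> (x \<otimes> star A x)"
    by (metis closed(1-6) m_assoc m_closed smult_closed UNIV_I complex_ring_simps(1))
  then show ?thesis by (simp add: unitary)
qed

lemma Z_add: "Z m \<otimes> Z n = Z (m + n)" and Zs_add: "Zs m \<otimes> Zs n = Zs (m + n)"
  and Y_add: "Y m \<otimes> Y n = Y (m + n)"
  by (auto simp: Z_def Zs_def Y_def nat_pow_mult)

lemma Y_Z: "Y p \<otimes> Z n = Q (- int (p * n)) \<odot> (Z n \<otimes> Y p)"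
  using q_commute_pow_left[OF _ _ q_commute_pow_right[OF _ _ y_z], of n p]
  by (simp add: Y_def Z_def Q_power algebra_simps)

lemma Y_Zs: "Y p \<otimes> Zs n = Q (int (p * n)) \<odot> (Zs n \<otimes> Y p)"
  using q_commute_pow_left[OF _ _ q_commute_pow_right[OF _ _ y_star_z], of n p]
  by (simp add: Y_def Zs_def Q_power algebra_simps)

lemma X_Z: "X r \<otimes> Z n = Z n \<otimes> X r" and X_Zs: "X r \<otimes> Zs n = Zs n \<otimes> X r" and X_Y: "X r \<otimes> Y n = Y n \<otimes> X r"
  using q_commute_pow_right[of "X r" _ 1] X_z[of r] X_star_z[of r] X_y[of r]
  by (auto simp: Z_def Zs_def Y_def one_smult)

lemma comm_left:
  assumes "w \<in> carrier A"
  shows "Z m \<otimes> (Z n \<otimes> w) = Z (m + n) \<otimes> w" "Zs m \<otimes> (Zs n \<otimes> w) = Zs (m + n) \<otimes> w"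
    "Y m \<otimes> (Y n \<otimes> w) = Y (m + n) \<otimes> w" "X r \<otimes> (X t \<otimes> w) = X (r + t) \<otimes> w"
    "Y p \<otimes> (Z n \<otimes> w) = Q (- int (p * n)) \<odot> (Z n \<otimes> (Y p \<otimes> w))"
    "Y p \<otimes> (Zs n \<otimes> w) = Q (int (p * n)) \<odot> (Zs n \<otimes> (Y p \<otimes> w))"
    "X r \<otimes> (Z n \<otimes> w) = Z n \<otimes> (X r \<otimes> w)" "X r \<otimes> (Zs n \<otimes> w) = Zs n \<otimes> (X r \<otimes> w)"
    "X r \<otimes> (Y n \<otimes> w) = Y n \<otimes> (X r \<otimes> w)"
  using assms q_commute_left[OF _ _ _ Y_Z] q_commute_left[OF _ _ _ Y_Zs]
  by (simp_all add: m_assoc[symmetric] Z_add Zs_add Y_add X_X X_Z X_Zs X_Y)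

text \<open>
  These rules move every power of \<open>\<zeta>\<^sub>1\<close> to the right of the powers of \<open>\<zeta>\<^sub>0\<close> and \<open>\<zeta>\<^sub>0\<^sup>*\<close>,
  every power of \<open>\<xi>\<close> to the far right and all scalars to the front, and they merge adjacent powers.
  The order of \<open>\<zeta>\<^sub>0\<close> and \<open>\<zeta>\<^sub>0\<^sup>*\<close> is kept. Rewriting \<open>\<zeta>\<^sub>0\<zeta>\<^sub>0\<^sup>*\<close> as \<open>1 - a\<close> would produce sums,
  whereas now each word has a single term as its normal form, and the products of factors
  \<open>1 - q\<^sup>2\<^sup>j a\<close> enter as the words \<open>\<zeta>\<^sub>0\<^sup>n\<zeta>\<^sub>0\<^sup>*\<^sup>n\<close> and \<open>\<zeta>\<^sub>0\<^sup>*\<^sup>n\<zeta>\<^sub>0\<^sup>n\<close> that they are equal to.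
\<close>

lemmas normal_order = m_assoc smult_mult_left smult_mult_right smult_smult
  Q_add Q_0 one_smult Z_add Zs_add Y_add X_X Y_Z Y_Zs X_Z X_Zs X_Y comm_left

lemma powers_0: "Z 0 = \<one>" "Zs 0 = \<one>" "Y 0 = \<one>" "X 0 = \<one>"
  by (auto simp: Z_def Zs_def Y_def X_simps)

lemma star_powers: "star A (Z n) = Zs n" "star A (Zs n) = Z n" "star A (Y n) = Y n \<otimes> X (int n)" "star A (X r) = X (- r)"
proof -
  show "star A (Z n) = Zs n" "star A (Zs n) = Z n" by (simp_all add: Z_def Zs_def star_pow star_star)
  have "star A y [^] n = y [^] n \<otimes> x [^] n"
    unfolding star_y using X_y[of 1] by (intro pow_mult_distrib) (auto simp: X_simps)
  then show "star A (Y n) = Y n \<otimes> X (int n)" by (simp add: Y_def X_simps star_pow)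
  show "star A (X r) = X (- r)"
    by (cases r rule: int_cases2) (auto simp: X_simps star_pow star_star)
qed

lemma Z_Zs_1: "Z 1 \<otimes> Zs 1 = \<one> \<ominus> a" and Zs_Z_1: "Zs 1 \<otimes> Z 1 = \<one> \<ominus> Q (-2) \<odot> a"
proof -
  have a: "y \<otimes> y \<otimes> x = a" by (simp add: a_def Y_def X_simps numeral_2_eq_2)
  have r: "z \<otimes> star A z \<oplus> a = \<one>"
    "z \<otimes> star A z = star A z \<otimes> z \<oplus> (Q (-2) - 1) \<odot> a"
    using rels unfolding seifert_rels_def a Q_def by auto
  then show 1: "Z 1 \<otimes> Zs 1 = \<one> \<ominus> a"
    by (auto simp: Z_def Zs_def a_minus_def a_assoc r_neg r_zero dest!: sym[of _ "\<one>"])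
  have "\<one> = star A z \<otimes> z \<oplus> ((Q (-2) - 1) \<odot> a \<oplus> a)"
    using r by (simp add: a_assoc)
  also have "(Q (-2) - 1) \<odot> a \<oplus> a = Q (-2) \<odot> a"
    using smult_l_distr[of "Q (-2) - 1" 1 a] by (simp add: one_smult)
  finally have 2: "star A z \<otimes> z \<oplus> Q (-2) \<odot> a = \<one>" by (rule sym)
  have "star A z \<otimes> z = (star A z \<otimes> z \<oplus> Q (-2) \<odot> a) \<ominus> Q (-2) \<odot> a"
    by (simp add: a_minus_def a_assoc r_neg)
  then show "Zs 1 \<otimes> Z 1 = \<one> \<ominus> Q (-2) \<odot> a"
    unfolding 2 by (simp add: Z_def Zs_def)
qed

text \<open>
  The innermost pair \<open>\<zeta>\<^sub>0\<zeta>\<^sub>0\<^sup>*\<close> equals \<open>1 - a\<close>, and pulling this factor to the right through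
  \<open>\<zeta>\<^sub>0\<^sup>*\<^sup>n\<close> replaces \<open>a\<close> by \<open>q\<^sup>2\<^sup>n a\<close>.
\<close>

lemma Z_Zs: "Z n \<otimes> Zs n = ordered_prod A (\<lambda>m. \<one> \<ominus> Q (2 * int m) \<odot> a) 0 n"
proof (induction n)
  case 0
  then show ?case by (simp add: ordered_prod_empty powers_0)
next
  case (Suc n)
  have "Z (Suc n) \<otimes> Zs (Suc n) = (Z n \<otimes> Z 1) \<otimes> (Zs 1 \<otimes> Zs n)"
    by (simp add: Z_add Zs_add)
  also have "\<dots> = Z n \<otimes> ((Z 1 \<otimes> Zs 1) \<otimes> Zs n)" by (simp add: m_assoc)
  also have "\<dots> = (Z n \<otimes> Zs n) \<otimes> (\<one> \<ominus> Q (2 * int n) \<odot> a)"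
    unfolding Z_Zs_1 by (simp add: mult_minus_distr a_def normal_order)
  finally show ?case using Suc by (simp add: ordered_prod_Suc)
qed

text \<open>
  The innermost pair is \<open>\<zeta>\<^sub>0\<^sup>*\<zeta>\<^sub>0 = 1 - q\<^sup>-\<^sup>2 a\<close>, which is why the product starts at
  index \<open>1\<close>, and passing \<open>\<zeta>\<^sub>0\<^sup>n\<close> contributes \<open>q\<^sup>-\<^sup>2\<^sup>n\<close>.
\<close>

lemma Zs_Z: "Zs n \<otimes> Z n = ordered_prod A (\<lambda>m. \<one> \<ominus> Q (- 2 * int m) \<odot> a) 1 (n + 1)"
proof (induction n)
  case 0
  then show ?case by (simp add: ordered_prod_empty powers_0)
next
  case (Suc n)
  have "Zs (Suc n) \<otimes> Z (Suc n) = (Zs n \<otimes> Zs 1) \<otimes> (Z 1 \<otimes> Z n)"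
    by (simp add: Z_add Zs_add)
  also have "\<dots> = Zs n \<otimes> ((Zs 1 \<otimes> Z 1) \<otimes> Z n)" by (simp add: m_assoc)
  also have "\<dots> = (Zs n \<otimes> Z n) \<otimes> (\<one> \<ominus> Q (- 2 * int (n + 1)) \<odot> a)"
    unfolding Zs_Z_1 by (simp add: mult_minus_distr a_def normal_order algebra_simps)
  finally show ?case using Suc ordered_prod_Suc[of 1 "Suc n"] by simp
qed

lemma star_a: "star A a = a"
  by (simp add: a_def star_mult star_powers normal_order)

section \<open>Relations between the generators of the coinvariants\<close>

text \<open>
  Both sides of each relation have the same normal form.
\<close>

lemma even_relations:
  fixes l :: nat and s :: int
  defines "c \<equiv> Z l \<otimes> X s"
  shows "a \<otimes> c = Q (- 2 * int l) \<odot> (c \<otimes> a)"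
    "c \<otimes> star A c = Z l \<otimes> Zs l"
    "star A c \<otimes> c = Zs l \<otimes> Z l"
  by (simp_all add: c_def a_def star_mult star_powers normal_order powers_0 add.commute)

lemma odd_relations:
  fixes l :: nat and k s :: int
  assumes k: "k = 2 * s - 1"
  defines "b \<equiv> Z l \<otimes> Y 1 \<otimes> X s" and "c \<equiv> Z (2 * l) \<otimes> X k"
  shows "a \<otimes> b = Q (- 2 * int l) \<odot> (b \<otimes> a)"
    "a \<otimes> c = Q (- 4 * int l) \<odot> (c \<otimes> a)"
    "b \<otimes> b = Q (3 * int l) \<odot> (a \<otimes> c)"
    "b \<otimes> c = Q (- 2 * int l) \<odot> (c \<otimes> b)"
    "b \<otimes> star A b = Q (2 * int l) \<odot> (a \<otimes> (Z l \<otimes> Zs l))"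
    "star A b \<otimes> b = a \<otimes> (Zs l \<otimes> Z l)"
    "star A b \<otimes> c = Q (- int l) \<odot> ((Zs l \<otimes> Z l) \<otimes> b)"
    "c \<otimes> star A b = Q (int l) \<odot> (b \<otimes> (Z l \<otimes> Zs l))"
    "c \<otimes> star A c = Z (2 * l) \<otimes> Zs (2 * l)"
    "star A c \<otimes> c = Zs (2 * l) \<otimes> Z (2 * l)"
  by (simp_all add: b_def c_def a_def k star_mult star_powers normal_order powers_0
      numeral_2_eq_2 mult_2 algebra_simps)

section \<open>Monomials\<close>

text \<open>
  Generating the span inductively, one term at a time, lets linear properties be proved by
  induction, without a choice of coefficients for an element.
\<close>

inductive_set monomial_span :: "'a set" where
  monomial: "Z m \<otimes> (Y p \<otimes> X r) \<in> monomial_span"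
| star_monomial: "Zs m \<otimes> (Y p \<otimes> X r) \<in> monomial_span"
| add: "v \<in> monomial_span \<Longrightarrow> w \<in> monomial_span \<Longrightarrow> v \<oplus> w \<in> monomial_span"
| smult: "v \<in> monomial_span \<Longrightarrow> c \<odot> v \<in> monomial_span"

lemma monomial_span_closed: "v \<in> monomial_span \<Longrightarrow> v \<in> carrier A"
  by (induction rule: monomial_span.induct) auto

lemma monomial_span_minus: "v \<in> monomial_span \<Longrightarrow> w \<in> monomial_span \<Longrightarrow> v \<ominus> w \<in> monomial_span"
  using monomial_span_closed by (simp add: a_minus_def uminus_eq_smult monomial_span.intros)

lemma monomial_span_lmultI:
  assumes u: "u \<in> carrier A"
    and "\<And>m p r. u \<otimes> (Z m \<otimes> (Y p \<otimes> X r)) \<in> monomial_span"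
    and "\<And>m p r. u \<otimes> (Zs m \<otimes> (Y p \<otimes> X r)) \<in> monomial_span"
    and "v \<in> monomial_span"
  shows "u \<otimes> v \<in> monomial_span"
  using assms(4)
  by (induction rule: monomial_span.induct)
    (use assms(2,3) u monomial_span_closed in \<open>auto simp: r_distr smult_mult_right intro: monomial_span.intros\<close>)

lemma monomial_span_Y: "v \<in> monomial_span \<Longrightarrow> Y n \<otimes> v \<in> monomial_span"
  by (rule monomial_span_lmultI) (auto simp: normal_order intro!: monomial_span.intros)

lemma monomial_span_X: "v \<in> monomial_span \<Longrightarrow> X n \<otimes> v \<in> monomial_span"
  by (rule monomial_span_lmultI) (auto simp: normal_order intro!: monomial_span.intros)

text \<open>
  In front of a monomial with a factor \<open>\<zeta>\<^sub>0\<^sup>*\<close> the new \<open>\<zeta>\<^sub>0\<close> meets it in a pair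
  \<open>\<zeta>\<^sub>0\<zeta>\<^sub>0\<^sup>* = 1 - a\<close>, and up to a scalar \<open>a\<close> only changes the powers of \<open>\<zeta>\<^sub>1\<close> and \<open>\<xi>\<close>.
\<close>

lemma monomial_span_Z: "v \<in> monomial_span \<Longrightarrow> Z 1 \<otimes> v \<in> monomial_span"
proof (rule monomial_span_lmultI)
  fix m p r
  show "Z 1 \<otimes> (Zs m \<otimes> (Y p \<otimes> X r)) \<in> monomial_span"
  proof (cases m)
    case 0
    then show ?thesis using monomial_span.monomial[of 1 p r] by (simp add: powers_0)
  next
    case (Suc n)
    let ?v = "Zs n \<otimes> (Y p \<otimes> X r)"
    have "Z 1 \<otimes> (Zs m \<otimes> (Y p \<otimes> X r)) = (Z 1 \<otimes> Zs 1) \<otimes> ?v"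
      using Suc by (simp add: m_assoc comm_left)
    also have "\<dots> = ?v \<ominus> Y 2 \<otimes> (X 1 \<otimes> ?v)"
      unfolding Z_Zs_1 by (simp add: mult_minus_distr a_def m_assoc)
    also have "\<dots> \<in> monomial_span"
      by (intro monomial_span_minus monomial_span_X monomial_span_Y monomial_span.intros)
    finally show ?thesis .
  qed
qed (auto simp: normal_order intro!: monomial_span.intros)

lemma monomial_span_Zs: "v \<in> monomial_span \<Longrightarrow> Zs 1 \<otimes> v \<in> monomial_span"
proof (rule monomial_span_lmultI)
  fix m p r
  show "Zs 1 \<otimes> (Z m \<otimes> (Y p \<otimes> X r)) \<in> monomial_span"
  proof (cases m)
    case 0
    then show ?thesis using monomial_span.star_monomial[of 1 p r] by (simp add: powers_0)
  next
    case (Suc n)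
    let ?v = "Z n \<otimes> (Y p \<otimes> X r)"
    have "Zs 1 \<otimes> (Z m \<otimes> (Y p \<otimes> X r)) = (Zs 1 \<otimes> Z 1) \<otimes> ?v"
      using Suc by (simp add: m_assoc comm_left)
    also have "\<dots> = ?v \<ominus> Q (-2) \<odot> (Y 2 \<otimes> (X 1 \<otimes> ?v))"
      unfolding Zs_Z_1 by (simp add: mult_minus_distr a_def m_assoc smult_mult_left)
    also have "\<dots> \<in> monomial_span"
      by (intro monomial_span_minus monomial_span_X monomial_span_Y monomial_span.intros)
    finally show ?thesis .
  qed
qed (auto simp: normal_order intro!: monomial_span.intros)

text \<open>
  Up to scalars, taking adjoints exchanges the two families of monomials; as
  \<open>\<zeta>\<^sub>1\<^sup>*\<^sup>p = \<zeta>\<^sub>1\<^sup>p\<xi>\<^sup>p\<close>, the exponent \<open>r\<close> of \<open>\<xi>\<close> becomes \<open>p - r\<close>. So only the first family has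
  to be written in terms of the generators.
\<close>

lemma star_monomial_in_star_subalgebra:
  assumes B: "star_subalgebra B A" and v: "Z m \<otimes> (Y p \<otimes> X (int p - r)) \<in> B"
  shows "Zs m \<otimes> (Y p \<otimes> X r) \<in> B"
proof -
  have "Zs m \<otimes> (Y p \<otimes> X r) = Q (- int (p * m)) \<odot> star A (Z m \<otimes> (Y p \<otimes> X (int p - r)))"
    by (simp add: star_mult star_powers normal_order algebra_simps)
  then show ?thesis using star_subalgebraD[OF B] v by metis
qed

lemma Z_X_pow: "(Z m \<otimes> X r) [^] (n::nat) = Z (m * n) \<otimes> X (r * int n)"
  by (induction n) (auto simp: powers_0 normal_order algebra_simps)

lemma a_pow: "a [^] (n::nat) = Y (2 * n) \<otimes> X (int n)"
  by (induction n) (auto simp: powers_0 normal_order algebra_simps a_def)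

text \<open>
  For a monomial with \<open>m\<close> factors \<open>\<zeta>\<^sub>0\<close>, \<open>p\<close> factors \<open>\<zeta>\<^sub>1\<close> and \<open>r\<close> factors \<open>\<xi>\<close> the
  hypothesis says that the coaction gives it degree \<open>0\<close>. Modulo \<open>l\<close> it reads \<open>k m = 0\<close>, and
  \<open>k\<close> is invertible modulo \<open>l\<close>. Afterwards \<open>k n + p\<close> is even, which is where the parity of
  \<open>k\<close> enters the classification of the coinvariants.
\<close>

lemma degree_zero_exponents:
  fixes k r :: int and l m p :: nat
  assumes l: "l > 0" "coprime k (int l)" and deg: "k * int m + int l * int p = 2 * int l * r"
  obtains n where "m = l * n" "k * int n + int p = 2 * r"
proof -
  have "k * int m = int l * (2 * r - int p)" using deg by (simp add: algebra_simps)
  then have "int l dvd k * int m" by simp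
  then have "int l dvd int m" using l by (simp add: coprime_dvd_mult_right_iff coprime_commute)
  then obtain n where n: "m = l * n" by auto
  have "int l * (k * int n + int p) = int l * (2 * r)" using deg by (simp add: n algebra_simps)
  then have "k * int n + int p = 2 * r" using l by simp
  with n show thesis by (rule that)
qed

text \<open>
  For \<open>k = 2s\<close> a monomial of degree \<open>0\<close> has \<open>m = ln\<close> and even \<open>p = 2t\<close>, and the exponent of
  \<open>\<xi>\<close> is then forced, so that it equals \<open>c\<^sub>+\<^sup>n a\<^sup>t\<close>.
\<close>

lemma even_monomial:
  assumes B: "star_subalgebra B A" and ac: "a \<in> B" "Z l \<otimes> X s \<in> B"
    and l: "l > 0" "coprime k (int l)" and k: "k = 2 * s"
    and deg: "k * int m + int l * int p = 2 * int l * r"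
  shows "Z m \<otimes> (Y p \<otimes> X r) \<in> B"
proof -
  obtain n where n: "m = l * n" and kn: "k * int n + int p = 2 * r"
    using degree_zero_exponents[OF l deg] .
  have r: "2 * s * int n + int p = 2 * r" using kn by (simp add: k)
  then have "int p = 2 * (r - s * int n)" by (simp add: algebra_simps)
  then have "even (int p)" by simp
  then obtain t where t: "p = 2 * t" by auto
  have r: "r = s * int n + int t" using r t by simp
  have "Z m \<otimes> (Y p \<otimes> X r) = (Z l \<otimes> X s) [^] n \<otimes> a [^] t"
    by (simp add: Z_X_pow a_pow normal_order n t r)
  then show ?thesis using star_subalgebraD[OF B] ac by metis
qed

text \<open>
  For odd \<open>k\<close> the exponents \<open>n = m / l\<close> and \<open>p\<close> have the same parity. If both are even the
  monomial is a product of powers of \<open>c\<^sub>-\<close> and \<open>a\<close>; if both are odd a single factor \<open>b\<close> absorbs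
  the remaining \<open>\<zeta>\<^sub>0\<^sup>l\<zeta>\<^sub>1\<close>.
\<close>

lemma odd_monomial:
  assumes B: "star_subalgebra B A" and abc: "a \<in> B" "Z l \<otimes> Y 1 \<otimes> X s \<in> B" "Z (2 * l) \<otimes> X k \<in> B"
    and l: "l > 0" "coprime k (int l)" and k: "k = 2 * s - 1"
    and deg: "k * int m + int l * int p = 2 * int l * r"
  shows "Z m \<otimes> (Y p \<otimes> X r) \<in> B"
proof -
  obtain n where n: "m = l * n" and r: "k * int n + int p = 2 * r"
    using degree_zero_exponents[OF l deg] .
  then have "even (k * int n + int p)" by simp
  then have parity: "even n \<longleftrightarrow> even p" by (simp add: k)
  show ?thesis
  proof (cases "even n")
    case True
    then obtain n' t where nt: "n = 2 * n'" "p = 2 * t" using parity by (auto elim!: evenE)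
    then have r: "r = k * int n' + int t" using r by (simp add: algebra_simps)
    have "Z m \<otimes> (Y p \<otimes> X r) = (Z (2 * l) \<otimes> X k) [^] n' \<otimes> a [^] t"
      by (simp add: Z_X_pow a_pow normal_order n nt r algebra_simps)
    then show ?thesis using star_subalgebraD[OF B] abc by metis
  next
    case False
    then obtain n' t where nt: "n = 2 * n' + 1" "p = 2 * t + 1" using parity by (auto elim!: oddE)
    then have r: "r = k * int n' + s + int t" using r by (simp add: k algebra_simps)
    have "Z m \<otimes> (Y p \<otimes> X r) = (Z (2 * l) \<otimes> X k) [^] n' \<otimes> (Z l \<otimes> Y 1 \<otimes> X s) \<otimes> a [^] t"
      by (simp add: Z_X_pow a_pow normal_order n nt r algebra_simps)
    then show ?thesis using star_subalgebraD[OF B] abc by metis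
  qed
qed

end

section \<open>Equalizers, generation and presented algebras\<close>

text \<open>
  Meant for the coaction and the map \<open>v \<mapsto> v \<otimes> 1\<close>, whose equalizer is the set of coinvariants.
\<close>

lemma star_subalgebra_equalizer:
  assumes A: "star_algebra A" and C: "star_algebra C"
    and f: "f \<in> star_hom A C" and g: "g \<in> star_hom A C"
  shows "star_subalgebra {v \<in> carrier A. f v = g v} A"
proof -
  interpret A: star_algebra A by fact
  interpret C: star_algebra C by fact
  note h = star_homD[OF f] star_homD[OF g]
  have "submodule {v \<in> carrier A. f v = g v} \<complex> A"
    by (rule A.submoduleI) (auto simp: h A.uminus_eq_smult star_hom_zero[OF A C f] star_hom_zero[OF A C g])
  then show ?thesis by (auto simp: star_subalgebra_def h A.star_closed)
qed

lemma star_generate_eqI: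
  assumes C: "star_subalgebra C A" and S: "S \<subseteq> C"
    and le: "\<And>B. star_subalgebra B A \<Longrightarrow> S \<subseteq> B \<Longrightarrow> C \<subseteq> B"
  shows "C = star_generate A S"
  unfolding star_generate_def using assms by (intro equalityI) blast+

text \<open>
  A presented algebra is spanned by words in the generators and their adjoints, and words are built
  by multiplying letters on from the left.
\<close>

lemma presented_star_algebra_induct:
  assumes X: "v \<in> carrier (presented_star_algebra R)"
    and one: "P \<one>\<^bsub>presented_star_algebra R\<^esub>"
    and add: "\<And>v w. P v \<Longrightarrow> P w \<Longrightarrow> P (v \<oplus>\<^bsub>presented_star_algebra R\<^esub> w)"
    and smult: "\<And>c v. P v \<Longrightarrow> P (c \<odot>\<^bsub>presented_star_algebra R\<^esub> v)"
    and gen: "\<And>g v. P v \<Longrightarrow> P (presented_gen R g \<otimes>\<^bsub>presented_star_algebra R\<^esub> v)"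
    and star_gen: "\<And>g v. P v \<Longrightarrow> P (star (presented_star_algebra R) (presented_gen R g) \<otimes>\<^bsub>presented_star_algebra R\<^esub> v)"
  shows "P v"
proof -
  interpret F: star_algebra "FSA :: (('a \<times> bool) list \<Rightarrow>\<^sub>0 complex) star_algebra" by (rule free_star_algebra)
  interpret S: star_algebra "presented_star_algebra R" by (rule presented_star_algebra)
  define \<pi> where "\<pi> = (\<lambda>w. relation_ideal R +>\<^bsub>FSA\<^esub> w)"
  note h = star_homD[OF pi_hom[of R], folded \<pi>_def, simplified]
  have \<pi>_gen: "\<pi> (Poly_Mapping.single [(g, False)] 1) = presented_gen R g" for g
    by (simp add: \<pi>_def presented_gen_def free_gen_def)
  have "\<pi> (Poly_Mapping.single [(g, True)] 1) = star (presented_star_algebra R) (presented_gen R g)" for g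
    using h(6)[of "Poly_Mapping.single [(g, False)] 1"] by (simp add: FSA_simps \<pi>_gen)
  then have step: "P w \<Longrightarrow> P (\<pi> (Poly_Mapping.single [d] 1) \<otimes>\<^bsub>presented_star_algebra R\<^esub> w)" for w d
    using gen star_gen \<pi>_gen by (cases d; cases "snd d") auto
  have word: "P (\<pi> (Poly_Mapping.single ds 1))" for ds
  proof (induction ds)
    case Nil
    then show ?case using one h(4) by (simp add: FSA_simps)
  next
    case (Cons d ds)
    then show ?case
      using step[OF Cons, of d] h(2)[of "Poly_Mapping.single [d] 1" "Poly_Mapping.single ds 1"]
      by (simp add: FSA_simps)
  qed
  have scaled: "P (\<pi> (Poly_Mapping.single ds c))" for ds c
    using smult[OF word, of c] h(5)[of c "Poly_Mapping.single ds 1"] by (simp add: FSA_simps)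
  obtain f where f: "v = \<pi> f"
    using X unfolding presented_star_algebra_def F.quot_carrier \<pi>_def by auto
  have "Poly_Mapping.keys f \<subseteq> UNIV" by simp
  then have "P (\<pi> f)"
  proof (induction f rule: poly_mapping_induct_on)
    case zero
    then show ?case using scaled[of _ 0] by simp
  next
    case (add f g)
    then show ?case using assms(3)[of "\<pi> f" "\<pi> g"] h(3)[of f g] by (simp add: FSA_simps)
  qed (rule scaled)
  then show ?thesis by (simp add: f)
qed

section \<open>Slice maps on tensor products\<close>

context star_algebra_pair begin

text \<open>
  The slice map \<open>id \<otimes> \<phi>\<close> for a linear functional \<open>\<phi>\<close>, on representatives in the free vector
  space on pairs. It is used with \<open>\<phi>\<close> the constant coefficient of a Laurent polynomial, to project
  onto the part of degree \<open>0\<close>.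
\<close>

definition slice where
  "slice \<phi> f = (\<Oplus>\<^bsub>A\<^esub>p\<in>Poly_Mapping.keys f. (Poly_Mapping.lookup f p * \<phi> (snd p)) \<odot>\<^bsub>A\<^esub> fst p)"

lemma slice_superset:
  assumes "finite K" "Poly_Mapping.keys f \<subseteq> K" "K \<subseteq> carrier A \<times> carrier B"
  shows "slice \<phi> f = (\<Oplus>\<^bsub>A\<^esub>p\<in>K. (Poly_Mapping.lookup f p * \<phi> (snd p)) \<odot>\<^bsub>A\<^esub> fst p)"
  unfolding slice_def using assms A.smult_l_null
  by (intro A.add.finprod_mono_neutral_cong_left) (auto simp: in_keys_iff)

lemma slice_closed: "f \<in> carrier T \<Longrightarrow> slice \<phi> f \<in> carrier A"
  unfolding slice_def by (rule A.finsum_closed) (auto simp: T_carrier)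

lemma slice_add:
  assumes "f \<in> carrier T" "g \<in> carrier T"
  shows "slice \<phi> (f \<oplus>\<^bsub>T\<^esub> g) = slice \<phi> f \<oplus>\<^bsub>A\<^esub> slice \<phi> g"
proof -
  let ?K = "Poly_Mapping.keys f \<union> Poly_Mapping.keys g"
  have K: "finite ?K" "?K \<subseteq> carrier A \<times> carrier B" using assms by (auto simp: T_carrier)
  have "slice \<phi> (f + g) = (\<Oplus>\<^bsub>A\<^esub>p\<in>?K. (Poly_Mapping.lookup f p * \<phi> (snd p)) \<odot>\<^bsub>A\<^esub> fst p \<oplus>\<^bsub>A\<^esub>
      (Poly_Mapping.lookup g p * \<phi> (snd p)) \<odot>\<^bsub>A\<^esub> fst p)"
    unfolding slice_superset[OF K(1) keys_add K(2)] using K(2)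
    by (intro A.add.finprod_cong') (auto simp: lookup_add distrib_right A.smult_l_distr[simplified])
  also have "\<dots> = (\<Oplus>\<^bsub>A\<^esub>p\<in>?K. (Poly_Mapping.lookup f p * \<phi> (snd p)) \<odot>\<^bsub>A\<^esub> fst p) \<oplus>\<^bsub>A\<^esub>
      (\<Oplus>\<^bsub>A\<^esub>p\<in>?K. (Poly_Mapping.lookup g p * \<phi> (snd p)) \<odot>\<^bsub>A\<^esub> fst p)"
    using K(2) by (intro A.finsum_addf) auto
  also have "\<dots> = slice \<phi> f \<oplus>\<^bsub>A\<^esub> slice \<phi> g"
    using slice_superset[OF K(1) _ K(2)] by simp
  finally show ?thesis by (simp add: T_simps)
qed

lemma slice_smult:
  assumes "f \<in> carrier T"
  shows "slice \<phi> (c \<odot>\<^bsub>T\<^esub> f) = c \<odot>\<^bsub>A\<^esub> slice \<phi> f"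
proof -
  have K: "Poly_Mapping.keys f \<subseteq> carrier A \<times> carrier B" using assms by (simp add: T_carrier)
  have l: "Poly_Mapping.lookup (c \<odot>\<^bsub>T\<^esub> f) p = c * Poly_Mapping.lookup f p" for p
    by (simp add: pair_algebra_def msa_smult_lookup)
  then have k: "Poly_Mapping.keys (c \<odot>\<^bsub>T\<^esub> f) \<subseteq> Poly_Mapping.keys f" by (auto simp: in_keys_iff)
  show ?thesis
    unfolding slice_superset[OF finite_keys k K] unfolding slice_def l using K
    by (subst A.finsum_smult_ldistr) (auto intro!: A.add.finprod_cong' simp: A.smult_smult mult.assoc)
qed

lemma slice_e: "v \<in> carrier A \<Longrightarrow> w \<in> carrier B \<Longrightarrow> slice \<phi> (e v w) = \<phi> w \<odot>\<^bsub>A\<^esub> v"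
  by (simp add: slice_def e_def)

lemma diff_eq_minus: "f \<in> carrier T \<Longrightarrow> g \<in> carrier T \<Longrightarrow> f - g = f \<oplus>\<^bsub>T\<^esub> (-1) \<odot>\<^bsub>T\<^esub> g"
  using T.uminus_eq_smult[of g] T_uminus[of g] by (simp add: T_simps)

text \<open>
  For linear \<open>\<phi>\<close> the expression \<open>\<phi>(w) v\<close> is bilinear in \<open>(v, w)\<close>, so that the slice map kills the
  relators that span the kernel. This is what lets it descend to the tensor product.
\<close>

lemma slice_tensor_kernel:
  assumes \<phi>: "\<And>v w. v \<in> carrier B \<Longrightarrow> w \<in> carrier B \<Longrightarrow> \<phi> (v \<oplus>\<^bsub>B\<^esub> w) = \<phi> v + \<phi> w"
      "\<And>c v. v \<in> carrier B \<Longrightarrow> \<phi> (c \<odot>\<^bsub>B\<^esub> v) = c * \<phi> v"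
    and n: "n \<in> N"
  shows "slice \<phi> n = \<zero>\<^bsub>A\<^esub>"
proof -
  have z: "slice \<phi> \<zero>\<^bsub>T\<^esub> = \<zero>\<^bsub>A\<^esub>" by (simp add: slice_def T_simps)
  have "N \<subseteq> {f \<in> carrier T. slice \<phi> f = \<zero>\<^bsub>A\<^esub>}"
  proof (rule N_min)
    show "submodule {f \<in> carrier T. slice \<phi> f = \<zero>\<^bsub>A\<^esub>} \<complex> T"
      by (rule T.submoduleI) (auto simp: T.uminus_eq_smult slice_smult slice_add A.smult_zero z)
    have diff: "slice \<phi> (f - g) = slice \<phi> f \<ominus>\<^bsub>A\<^esub> slice \<phi> g" "f - g \<in> carrier T"
      if "f \<in> carrier T" "g \<in> carrier T" for f g
      using that by (simp_all add: diff_eq_minus slice_add slice_smult a_minus_def A.uminus_eq_smult slice_closed)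
    have cancel: "u \<oplus>\<^bsub>A\<^esub> w \<ominus>\<^bsub>A\<^esub> u \<ominus>\<^bsub>A\<^esub> w = \<zero>\<^bsub>A\<^esub>" if "u \<in> carrier A" "w \<in> carrier A" for u w
    proof -
      have "u \<oplus>\<^bsub>A\<^esub> w \<ominus>\<^bsub>A\<^esub> u \<ominus>\<^bsub>A\<^esub> w = (u \<oplus>\<^bsub>A\<^esub> w) \<ominus>\<^bsub>A\<^esub> (u \<oplus>\<^bsub>A\<^esub> w)"
        using that by (simp add: a_minus_def A.a_assoc A.minus_add)
      then show ?thesis using that by (simp add: a_minus_def A.r_neg)
    qed
    have "slice \<phi> r = \<zero>\<^bsub>A\<^esub>" if "r \<in> bilinear_relators A B" for r
      using that
      by (cases rule: bil_cases)
        (simp_all add: diff e_c slice_e slice_smult \<phi> cancel A.smult_r_distr A.smult_l_distr[simplified] A.smult_smult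
          mult.commute A.r_neg a_minus_def[of A "c \<odot>\<^bsub>A\<^esub> v" "c \<odot>\<^bsub>A\<^esub> v" for c v])
    then show "bilinear_relators A B \<subseteq> {f \<in> carrier T. slice \<phi> f = \<zero>\<^bsub>A\<^esub>}" using rel_c by auto
  qed
  then show ?thesis using n by auto
qed

lemma slice_cong:
  assumes \<phi>: "\<And>v w. v \<in> carrier B \<Longrightarrow> w \<in> carrier B \<Longrightarrow> \<phi> (v \<oplus>\<^bsub>B\<^esub> w) = \<phi> v + \<phi> w"
      "\<And>c v. v \<in> carrier B \<Longrightarrow> \<phi> (c \<odot>\<^bsub>B\<^esub> v) = c * \<phi> v"
    and f: "f \<in> carrier T" and g: "g \<in> carrier T" and fg: "N +>\<^bsub>T\<^esub> f = N +>\<^bsub>T\<^esub> g"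
  shows "slice \<phi> f = slice \<phi> g"
proof -
  interpret N: ideal N T by (rule N_id)
  have "f \<in> N +>\<^bsub>T\<^esub> g" using N.a_rcos_self[OF f] fg by simp
  then obtain n where n: "n \<in> N" "f = n \<oplus>\<^bsub>T\<^esub> g" by (auto simp: a_r_coset_def r_coset_def)
  moreover have "n \<in> carrier T" using n N_closed(1) by auto
  ultimately show ?thesis
    using slice_tensor_kernel[of \<phi> n, OF \<phi>] slice_closed[OF g] by (simp add: slice_add g)
qed

lemma tt_hom_left: "(\<lambda>v. tt v \<one>\<^bsub>B\<^esub>) \<in> star_hom A TT"
  unfolding star_hom_def using tt(6)[OF A.one_closed B.one_closed]
  by (auto intro!: ring_hom_memI simp: tt(1-5) B.star_one)

end

section \<open>The grading by the coaction and its coinvariants\<close>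

locale seifert_coaction =
  fixes q :: real and k l :: int
  assumes nonzero: "q \<noteq> 0"
begin

sublocale seifert "O_Sigma q" q "zeta0 q" "zeta1 q" "xi q"
proof (intro seifert.intro O_Sigma seifert_axioms.intro)
  show "zeta0 q \<in> carrier (O_Sigma q)" "zeta1 q \<in> carrier (O_Sigma q)" "xi q \<in> carrier (O_Sigma q)"
    unfolding zeta0_def zeta1_def xi_def O_Sigma_def by (rule gen_c)+
qed (rule nonzero Sigma_rels)+

sublocale tens: star_algebra_pair "O_Sigma q" O_U1
  by (simp add: star_algebra_pair_def O_Sigma O_U1)

abbreviation "\<rho> \<equiv> coaction q k l"

lemma coaction: "\<rho> \<in> star_hom (O_Sigma q) tens.TT"
  "\<rho> (zeta0 q) = tens.tt (zeta0 q) (u_pow k)"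
  "\<rho> (zeta1 q) = tens.tt (zeta1 q) (u_pow l)"
  "\<rho> (xi q) = tens.tt (xi q) (u_pow (- 2 * l))"
  using theI'[OF coaction_ex1[of q k l], folded coaction_def] by auto

definition homogeneous :: "int \<Rightarrow> seifert_free set set" where
  "homogeneous d = {v \<in> carrier (O_Sigma q). \<rho> v = tens.tt v (u_pow d)}"

lemma homogeneous_mult: "v \<in> homogeneous c \<Longrightarrow> w \<in> homogeneous d \<Longrightarrow> v \<otimes>\<^bsub>O_Sigma q\<^esub> w \<in> homogeneous (c + d)"
  unfolding homogeneous_def by (simp add: star_homD(2)[OF coaction(1)] tens.tt(4) U_simps)

lemma homogeneous_star: "v \<in> homogeneous d \<Longrightarrow> star (O_Sigma q) v \<in> homogeneous (- d)"
  unfolding homogeneous_def by (simp add: star_homD(6)[OF coaction(1)] tens.tt(2) U_simps star_closed)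

lemma homogeneous_one: "\<one>\<^bsub>O_Sigma q\<^esub> \<in> homogeneous 0"
  unfolding homogeneous_def
  by (simp add: star_homD(4)[OF coaction(1)] tens.tt(6)[OF one_closed U_simps(1)] U_simps)

lemma homogeneous_pow: "v \<in> homogeneous d \<Longrightarrow> v [^]\<^bsub>O_Sigma q\<^esub> (n::nat) \<in> homogeneous (d * int n)"
proof (induction n)
  case (Suc n)
  then show ?case using homogeneous_mult[of _ "d * int n" v d] by (simp add: algebra_simps)
qed (simp add: homogeneous_one)

lemma homogeneous_powers:
  "Z n \<in> homogeneous (k * int n)" "Zs n \<in> homogeneous (- k * int n)"
  "Y n \<in> homogeneous (l * int n)" "X r \<in> homogeneous (- 2 * l * r)"
proof -
  have g: "zeta0 q \<in> homogeneous k" "zeta1 q \<in> homogeneous l" "xi q \<in> homogeneous (- 2 * l)"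
    by (auto simp: homogeneous_def coaction)
  show "Z n \<in> homogeneous (k * int n)" "Zs n \<in> homogeneous (- k * int n)" "Y n \<in> homogeneous (l * int n)"
    unfolding Z_def Zs_def Y_def using g by (intro homogeneous_pow homogeneous_star; simp)+
  show "X r \<in> homogeneous (- 2 * l * r)"
  proof (cases r rule: int_cases2)
    case (nonneg n)
    then show ?thesis using homogeneous_pow[OF g(3), of n] by (simp add: X_simps)
  next
    case (nonpos n)
    then show ?thesis using homogeneous_pow[OF homogeneous_star[OF g(3)], of n] by (simp add: X_simps)
  qed
qed

lemma homogeneous_monomials:
  "Z m \<otimes>\<^bsub>O_Sigma q\<^esub> (Y p \<otimes>\<^bsub>O_Sigma q\<^esub> X r) \<in> homogeneous (k * int m + l * int p - 2 * l * r)"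
  "Zs m \<otimes>\<^bsub>O_Sigma q\<^esub> (Y p \<otimes>\<^bsub>O_Sigma q\<^esub> X r) \<in> homogeneous (- k * int m + l * int p - 2 * l * r)"
proof -
  note YX = homogeneous_mult[OF homogeneous_powers(3,4), of p r]
  show "Z m \<otimes>\<^bsub>O_Sigma q\<^esub> (Y p \<otimes>\<^bsub>O_Sigma q\<^esub> X r) \<in> homogeneous (k * int m + l * int p - 2 * l * r)"
    using homogeneous_mult[OF homogeneous_powers(1)[of m] YX] by (simp add: algebra_simps)
  show "Zs m \<otimes>\<^bsub>O_Sigma q\<^esub> (Y p \<otimes>\<^bsub>O_Sigma q\<^esub> X r) \<in> homogeneous (- k * int m + l * int p - 2 * l * r)"
    using homogeneous_mult[OF homogeneous_powers(2)[of m] YX] by (simp add: algebra_simps)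
qed

lemma coinvariants_eq: "coinvariants q k l = homogeneous 0"
  by (simp add: coinvariants_def homogeneous_def U_simps)

lemma coinvariants_star_subalgebra: "star_subalgebra (coinvariants q k l) (O_Sigma q)"
  unfolding coinvariants_def
  by (rule star_subalgebra_equalizer[OF O_Sigma tens.tensor_star_algebra coaction(1) tens.tt_hom_left])

text \<open>
  The span contains \<open>1\<close>, and left multiplication by any of the six letters preserves it.
\<close>

lemma carrier_monomial_span:
  assumes "v \<in> carrier (O_Sigma q)"
  shows "v \<in> monomial_span"
proof -
  have letters: "zeta0 q = Z 1" "star (O_Sigma q) (zeta0 q) = Zs 1" "zeta1 q = Y 1"
    "star (O_Sigma q) (zeta1 q) = Y 1 \<otimes>\<^bsub>O_Sigma q\<^esub> X 1" "xi q = X 1" "star (O_Sigma q) (xi q) = X (- 1)"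
    by (simp_all add: Z_def Zs_def Y_def X_simps star_y)
  have gens: "presented_gen (seifert_relations q) g = (case g of Zeta0 \<Rightarrow> zeta0 q | Zeta1 \<Rightarrow> zeta1 q | Xi \<Rightarrow> xi q)" for g
    by (cases g) (simp_all add: zeta0_def zeta1_def xi_def)
  show ?thesis
    using assms unfolding O_Sigma_def
  proof (rule presented_star_algebra_induct, fold O_Sigma_def)
    show "\<one>\<^bsub>O_Sigma q\<^esub> \<in> monomial_span"
      using monomial_span.monomial[of 0 0 0] by (simp add: powers_0)
  next
    fix g w assume w: "w \<in> monomial_span"
    have "Y 1 \<otimes>\<^bsub>O_Sigma q\<^esub> X 1 \<otimes>\<^bsub>O_Sigma q\<^esub> w = Y 1 \<otimes>\<^bsub>O_Sigma q\<^esub> (X 1 \<otimes>\<^bsub>O_Sigma q\<^esub> w)"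
      using w by (intro m_assoc closed monomial_span_closed)
    then have "Y 1 \<otimes>\<^bsub>O_Sigma q\<^esub> X 1 \<otimes>\<^bsub>O_Sigma q\<^esub> w \<in> monomial_span"
      using monomial_span_Y[OF monomial_span_X[OF w]] by (simp only:)
    \<comment> \<open>Folded below, as \<open>Z 1\<close> itself mentions \<open>\<zeta>\<^sub>0\<close> and unfolding would not end.\<close>
    note products = monomial_span_Z[OF w] monomial_span_Zs[OF w] monomial_span_Y[OF w, of 1]
      this monomial_span_X[OF w, of 1] monomial_span_X[OF w, of "-1"]
    show "presented_gen (seifert_relations q) g \<otimes>\<^bsub>O_Sigma q\<^esub> w \<in> monomial_span"
      "star (O_Sigma q) (presented_gen (seifert_relations q) g) \<otimes>\<^bsub>O_Sigma q\<^esub> w \<in> monomial_span"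
      using products[folded letters] unfolding gens by (cases g; simp only: seifert_gen.case)+
  qed (rule monomial_span.add monomial_span.smult; assumption)+
qed

text \<open>
  The monomials are homogeneous, so projecting \<open>\<rho>(v)\<close> to degree \<open>0\<close> keeps those of degree \<open>0\<close> and
  kills the others: as every element is a combination of monomials, the projection always lands in
  \<open>B\<close>. For a coinvariant \<open>v\<close> the projection of \<open>\<rho>(v) = v \<otimes> 1\<close> is \<open>v\<close> itself.
\<close>

lemma coinvariants_subset:
  assumes B: "star_subalgebra B (O_Sigma q)"
    and mono: "\<And>m p r. k * int m + l * int p = 2 * l * r \<Longrightarrow> Z m \<otimes>\<^bsub>O_Sigma q\<^esub> (Y p \<otimes>\<^bsub>O_Sigma q\<^esub> X r) \<in> B"
  shows "coinvariants q k l \<subseteq> B"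
proof
  define \<phi> :: "(int \<Rightarrow>\<^sub>0 complex) \<Rightarrow> complex" where "\<phi> b = Poly_Mapping.lookup b 0" for b
  have \<phi>: "\<phi> (v \<oplus>\<^bsub>O_U1\<^esub> w) = \<phi> v + \<phi> w" "\<phi> (c \<odot>\<^bsub>O_U1\<^esub> v) = c * \<phi> v" for v w c
    by (simp_all add: \<phi>_def O_U1_def msa_add msa_smult_lookup lookup_add)
  have \<phi>_u: "\<phi> (u_pow d) = (if d = 0 then 1 else 0)" for d
    by (simp add: \<phi>_def u_pow_def lookup_single when_def)
  note B' = star_subalgebraD[OF B]
  note q = tens.T.quot_simps[OF tens.N_id] tens.T.quot_smult[OF tens.N_id]
  \<comment> \<open>The slice map lives on representatives, so each vector is accompanied by one of its image.\<close>
  let ?lift = "\<lambda>v f. f \<in> carrier tens.T \<and> \<rho> v = tens.N +>\<^bsub>tens.T\<^esub> f"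
  have homog: "\<exists>f. ?lift v f \<and> tens.slice \<phi> f \<in> B" if "v \<in> homogeneous d" "d = 0 \<Longrightarrow> v \<in> B" for v d
  proof (intro exI conjI)
    have v: "v \<in> carrier (O_Sigma q)" using that by (simp add: homogeneous_def)
    show "tens.e v (u_pow d) \<in> carrier tens.T" by (simp add: tens.e_c v U_simps)
    show "\<rho> v = tens.N +>\<^bsub>tens.T\<^esub> tens.e v (u_pow d)"
      using that by (simp add: homogeneous_def tens.tt_def')
    show "tens.slice \<phi> (tens.e v (u_pow d)) \<in> B"
      using v that B'(2) smult_l_null by (simp add: tens.slice_e U_simps \<phi>_u one_smult)
  qed
  fix v assume v: "v \<in> coinvariants q k l"
  then have vc: "v \<in> carrier (O_Sigma q)" by (simp add: coinvariants_def)
  then have "v \<in> monomial_span" by (rule carrier_monomial_span)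
  then have "\<exists>f. ?lift v f \<and> tens.slice \<phi> f \<in> B"
  proof (induction rule: monomial_span.induct)
    case (monomial m p r)
    show ?case by (rule homog[OF homogeneous_monomials(1)]) (auto intro: mono)
  next
    case (star_monomial m p r)
    show ?case
      by (rule homog[OF homogeneous_monomials(2)], rule star_monomial_in_star_subalgebra[OF B], rule mono)
        (simp add: algebra_simps)
  next
    case (add v w)
    then obtain f g where f: "?lift v f" "tens.slice \<phi> f \<in> B" and g: "?lift w g" "tens.slice \<phi> g \<in> B" by blast
    have "?lift (v \<oplus>\<^bsub>O_Sigma q\<^esub> w) (f \<oplus>\<^bsub>tens.T\<^esub> g)"
      using f g star_homD(3)[OF coaction(1) monomial_span_closed monomial_span_closed, OF add.hyps]
      by (simp add: tensor_algebra_def q)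
    moreover have "tens.slice \<phi> (f \<oplus>\<^bsub>tens.T\<^esub> g) \<in> B" using f g B' by (simp add: tens.slice_add)
    ultimately show ?case by blast
  next
    case (smult v c)
    then obtain f where f: "?lift v f" "tens.slice \<phi> f \<in> B" by blast
    have "?lift (c \<odot>\<^bsub>O_Sigma q\<^esub> v) (c \<odot>\<^bsub>tens.T\<^esub> f)"
      using f star_homD(5)[OF coaction(1) monomial_span_closed, OF smult.hyps]
      by (simp add: tensor_algebra_def q)
    moreover have "tens.slice \<phi> (c \<odot>\<^bsub>tens.T\<^esub> f) \<in> B" using f B' by (simp add: tens.slice_smult)
    ultimately show ?case by blast
  qed
  then obtain f where f: "?lift v f" "tens.slice \<phi> f \<in> B" by blast
  have "tens.slice \<phi> f = tens.slice \<phi> (tens.e v (u_pow 0))"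
    by (rule tens.slice_cong) (use f v vc \<phi> in \<open>auto simp: tens.e_c U_simps coinvariants_def tens.tt_def'\<close>)
  also have "\<dots> = v" using vc by (simp add: tens.slice_e U_simps \<phi>_u one_smult)
  finally show "v \<in> B" using f by simp
qed

end

theorem proposition2p1:
  fixes q :: real and k :: int and l :: nat
  assumes "0 < q" and "q < 1" and "l > 0" and "coprime k (int l)"
  shows
    "(\<forall>s. k = 2 * s \<longrightarrow>
       (let A = O_Sigma q;
            Q = (\<lambda>n::int. complex_of_real (q powi n));
            a = zeta1 q [^]\<^bsub>A\<^esub> (2::nat) \<otimes>\<^bsub>A\<^esub> xi q;
            c = zeta0 q [^]\<^bsub>A\<^esub> l \<otimes>\<^bsub>A\<^esub> xi_pow q s
        in coinvariants q k (int l) = star_generate A {a, c} \<and>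
           star A a = a \<and>
           a \<otimes>\<^bsub>A\<^esub> c = Q (- 2 * int l) \<odot>\<^bsub>A\<^esub> (c \<otimes>\<^bsub>A\<^esub> a) \<and>
           c \<otimes>\<^bsub>A\<^esub> star A c = prod_pos q a 0 l \<and>
           star A c \<otimes>\<^bsub>A\<^esub> c = prod_neg q a 1 (l + 1))) \<and>
     (\<forall>s. k = 2 * s - 1 \<longrightarrow>
       (let A = O_Sigma q;
            Q = (\<lambda>n::int. complex_of_real (q powi n));
            a = zeta1 q [^]\<^bsub>A\<^esub> (2::nat) \<otimes>\<^bsub>A\<^esub> xi q;
            b = zeta0 q [^]\<^bsub>A\<^esub> l \<otimes>\<^bsub>A\<^esub> zeta1 q \<otimes>\<^bsub>A\<^esub> xi_pow q s;
            c = zeta0 q [^]\<^bsub>A\<^esub> (2 * l) \<otimes>\<^bsub>A\<^esub> xi_pow q k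
        in coinvariants q k (int l) = star_generate A {a, b, c} \<and>
           star A a = a \<and>
           a \<otimes>\<^bsub>A\<^esub> b = Q (- 2 * int l) \<odot>\<^bsub>A\<^esub> (b \<otimes>\<^bsub>A\<^esub> a) \<and>
           a \<otimes>\<^bsub>A\<^esub> c = Q (- 4 * int l) \<odot>\<^bsub>A\<^esub> (c \<otimes>\<^bsub>A\<^esub> a) \<and>
           b [^]\<^bsub>A\<^esub> (2::nat) = Q (3 * int l) \<odot>\<^bsub>A\<^esub> (a \<otimes>\<^bsub>A\<^esub> c) \<and>
           b \<otimes>\<^bsub>A\<^esub> c = Q (- 2 * int l) \<odot>\<^bsub>A\<^esub> (c \<otimes>\<^bsub>A\<^esub> b) \<and>
           b \<otimes>\<^bsub>A\<^esub> star A b = Q (2 * int l) \<odot>\<^bsub>A\<^esub> (a \<otimes>\<^bsub>A\<^esub> prod_pos q a 0 l) \<and>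
           star A b \<otimes>\<^bsub>A\<^esub> b = a \<otimes>\<^bsub>A\<^esub> prod_neg q a 1 (l + 1) \<and>
           star A b \<otimes>\<^bsub>A\<^esub> c = Q (- int l) \<odot>\<^bsub>A\<^esub> (prod_neg q a 1 (l + 1) \<otimes>\<^bsub>A\<^esub> b) \<and>
           c \<otimes>\<^bsub>A\<^esub> star A b = Q (int l) \<odot>\<^bsub>A\<^esub> (b \<otimes>\<^bsub>A\<^esub> prod_pos q a 0 l) \<and>
           c \<otimes>\<^bsub>A\<^esub> star A c = prod_pos q a 0 (2 * l) \<and>
           star A c \<otimes>\<^bsub>A\<^esub> c = prod_neg q a 1 (2 * l + 1)))"
proof -
  interpret seifert_coaction q k "int l" using assms by unfold_locales simp
  note generated = star_generate_eqI[OF coinvariants_star_subalgebra _ coinvariants_subset]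
  have a: "zeta1 q [^]\<^bsub>O_Sigma q\<^esub> (2::nat) \<otimes>\<^bsub>O_Sigma q\<^esub> xi q = a"
    by (simp add: a_def Y_def X_simps)
  have Q: "complex_of_real (q powi n) = Q n" for n by (simp only: Q_def)
  have P: "prod_pos q a 0 n = Z n \<otimes>\<^bsub>O_Sigma q\<^esub> Zs n" "prod_neg q a 1 (n + 1) = Zs n \<otimes>\<^bsub>O_Sigma q\<^esub> Z n" for n
    unfolding prod_pos_def prod_neg_def Q Z_Zs Zs_Z by (rule refl)+
  have a0: "a \<in> coinvariants q k (int l)"
    using homogeneous_mult[OF homogeneous_powers(3,4), of 2 1] by (simp add: coinvariants_eq a_def)
  show ?thesis
  proof (intro conjI allI impI, goal_cases)
    case (1 s)
    note k = \<open>k = 2 * s\<close>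
    let ?c = "Z l \<otimes>\<^bsub>O_Sigma q\<^esub> X s"
    have c: "zeta0 q [^]\<^bsub>O_Sigma q\<^esub> l \<otimes>\<^bsub>O_Sigma q\<^esub> xi_pow q s = ?c"
      by (simp add: Z_def X_def xi_pow_def)
    have "?c \<in> coinvariants q k (int l)"
      unfolding coinvariants_eq using homogeneous_mult[OF homogeneous_powers(1,4), of l s]
      by (simp add: k algebra_simps)
    then have "coinvariants q k (int l) = star_generate (O_Sigma q) {a, ?c}"
      by (intro generated even_monomial[OF _ _ _ assms(3,4) k]) (use a0 in simp_all)
    then show ?case
      unfolding Let_def a c Q P by (intro conjI star_a even_relations)
  next
    case (2 s)
    note k = \<open>k = 2 * s - 1\<close>
    let ?b = "Z l \<otimes>\<^bsub>O_Sigma q\<^esub> Y 1 \<otimes>\<^bsub>O_Sigma q\<^esub> X s"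
    let ?c = "Z (2 * l) \<otimes>\<^bsub>O_Sigma q\<^esub> X k"
    have b: "zeta0 q [^]\<^bsub>O_Sigma q\<^esub> l \<otimes>\<^bsub>O_Sigma q\<^esub> zeta1 q \<otimes>\<^bsub>O_Sigma q\<^esub> xi_pow q s = ?b"
      by (simp add: Z_def X_def Y_def xi_pow_def)
    have c: "zeta0 q [^]\<^bsub>O_Sigma q\<^esub> (2 * l) \<otimes>\<^bsub>O_Sigma q\<^esub> xi_pow q k = ?c"
      by (simp add: Z_def X_def xi_pow_def)
    have b2: "?b [^]\<^bsub>O_Sigma q\<^esub> (2::nat) = ?b \<otimes>\<^bsub>O_Sigma q\<^esub> ?b"
      by (rule pow2) (simp_all add: monoid_axioms)
    have "?b \<in> coinvariants q k (int l)"
      unfolding coinvariants_eq using homogeneous_mult[OF homogeneous_mult, OF homogeneous_powers(1,3,4), of l 1 s]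
      by (simp add: k algebra_simps)
    moreover have "?c \<in> coinvariants q k (int l)"
      using homogeneous_mult[OF homogeneous_powers(1,4), of "2 * l" k] by (simp add: coinvariants_eq algebra_simps)
    ultimately have "coinvariants q k (int l) = star_generate (O_Sigma q) {a, ?b, ?c}"
      by (intro generated odd_monomial[OF _ _ _ _ assms(3,4) k]) (use a0 in simp_all)
    then show ?case
      unfolding Let_def a b c Q P b2 using odd_relations[OF k, of l] by (intro conjI star_a) simp_all
  qed
qed

end
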